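(* Let $\nu>0$, $R>0$, and let $O_+=\{(p,q)\in\mathbb{R}^2\mid|p|+|q|<R\}$. Let $D_0\subset O_+$ be an open set. Let $\{D_t\}_{t\ge0}$ be the open evolution of $V=-\kappa+\nu$ with initial set $D_0$ and obstacles $O_-=\emptyset$ and $O_+$, and let $\{E_t\}_{t\ge0}$ be the closed evolution of $V=-\kappa+\nu$ with initial set $E_0=\overline{D_0}$ and obstacles $C_-=\emptyset$ and $C_+=\overline{O_+}$. Set $$A:=\bigcup\big\{B_{\nu^{-1}}(z)\ \big|\ B_{\nu^{-1}}(z)\subset O_+,\ z\in\mathbb{R}^2\big\}.$$ Assume one of the following: 1. $R=\sqrt2\,\nu^{-1}$ and $B_{\nu^{-1}}((0,0))\subset D_0$; 2. $R<\sqrt2\,\nu^{-1}$; 3. $R>\sqrt2\,\nu^{-1}$ and $B(\hat z,\nu^{-1}+\delta)\subset D_0$ for some $\hat z\in\mathbb{R}^2$ and $\delta>0$. Then $$A\subset\varliminf_{t\to\infty}D_t\subset\varlimsup_{t\to\infty}D_t\subset\overline A$$ and $$A\subset\varliminf_{t\to\infty}E_t\subset\varlimsup_{t\to\infty}E_t\subset\overline A.$$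
   Context: $B_r(z)=B(z,r)$ is the open ball of radius $r$ centered at $z$. For a family of sets, $\varlimsup_{t\to\infty}D_t:=\bigcap_{\tau>0}\bigcup_{t>\tau}D_t$ and $\varliminf_{t\to\infty}D_t:=\bigcup_{\tau>0}\bigcap_{t>\tau}D_t$. Below $d=2$. Let $\mathbb{S}^d$ be the real symmetric $d\times d$ matrices, and $F(p,X)=-\mathrm{Tr}\big((I-\frac{p\otimes p}{|p|^2})X\big)$ for $p\in\mathbb{R}^d\setminus\{0\}$, $X\in\mathbb{S}^d$. Upper and lower stars denote upper and lower semicontinuous envelopes. For $\nu\in\mathbb{R}$, Lipschitz functions $\Psi_-\le\Psi_+$ on $\mathbb{R}^d$ and $u_0\in C(\mathbb{R}^d)$, consider the obstacle problem (P): $u_t-\nu|Du|+F(Du,D^2u)=0$ in $\mathbb{R}^d\times(0,\infty)$, $u(\cdot,0)=u_0$, $\Psi_-(x)\le u(x,t)\le\Psi_+(x)$ in $\mathbb{R}^d\times(0,\infty)$. $u$ is a viscosity subsolution of (P) if (a) $\Psi_-(x)\le u^*(x,t)\le\Psi_+(x)$ for all $(x,t)\in\mathbb{R}^d\times(0,\infty)$; (b) $u^*(x,0)\le u_0(x)$ for all $x$; (c) whenever $\phi$ is smooth, $u^*-\phi$ has a local maximum at $(x_0,t_0)\in\mathbb{R}^d\times(0,\infty)$ and $u^*(x_0,t_0)>\Psi_-(x_0)$, one has $\phi_t-\nu|D\phi|+F_*(D\phi,D^2\phi)\le0$ at $(x_0,t_0)$. $u$ is a viscosity supersolution if (a) $\Psi_-(x)\le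 u_*(x,t)\le\Psi_+(x)$ for all $(x,t)\in\mathbb{R}^d\times(0,\infty)$; (b) $u_*(x,0)\ge u_0(x)$ for all $x$; (c) whenever $\phi$ is smooth, $u_*-\phi$ has a local minimum at $(x_0,t_0)\in\mathbb{R}^d\times(0,\infty)$ and $u_*(x_0,t_0)<\Psi_+(x_0)$, one has $\phi_t-\nu|D\phi|+F^*(D\phi,D^2\phi)\ge0$ at $(x_0,t_0)$. A viscosity solution is both. For a constant $a<0$ let $K_a(\mathbb{R}^d\times[0,\infty))$ be the set of $u\in C(\mathbb{R}^d\times[0,\infty))$ such that for all $T>0$ there is $R>0$ with $u=a$ on $\{|x|\ge R\}\times[0,T]$. Open evolution: for open sets $D_0,O_-,O_+$, a family of open sets $\{D_t\}_{t\ge0}$ is the open evolution of $V=-\kappa+\nu$ with initial set $D_0$ and obstacles $O_-,O_+$ ($O_-\subset D_t\subset O_+$) if there exist Lipschitz $\Psi_\pm$, $u_0\in C(\mathbb{R}^d)$ and a viscosity solution $u\in K_a(\mathbb{R}^d\times[0,\infty))$ of (P) such that $O_\pm=\{\Psi_\pm>0\}$ and $D_t=\{x\mid u(x,t)>0\}$ for all $t\ge0$. Closed evolution: for closed sets $E_0,C_-,C_+$, the family of closed sets $\{E_t\}_{t\ge0}$ is defined in the same way with $C_\pm=\{\Psi_\pm\ge0\}$ and $E_t=\{x\mid u(x,t)\ge0\}$ for all $t\ge0$. Open and closed evolutions exist and are unique (known result). *)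

theory Defs
  imports "HOL-Analysis.Analysis"
begin

section \<open>Semicontinuous envelopes\<close>

text \<open>Envelopes of \<open>f\<close> regarded as a function on \<open>S\<close>, extended to the closure of \<open>S\<close>. The filter
  is that of the neighbourhoods of \<open>x\<close> in \<open>S\<close>, including \<open>x\<close> itself if \<open>x \<in> S\<close>. Values
  are extended reals because \<open>f\<close> need not be locally bounded.\<close>

definition usc_envelope :: "'a::topological_space set \<Rightarrow> ('a \<Rightarrow> real) \<Rightarrow> 'a \<Rightarrow> ereal" where
  "usc_envelope S f x = Limsup (inf (nhds x) (principal S)) (\<lambda>y. ereal (f y))"

definition lsc_envelope :: "'a::topological_space set \<Rightarrow> ('a \<Rightarrow> real) \<Rightarrow> 'a \<Rightarrow> ereal" where
  "lsc_envelope S f x = Liminf (inf (nhds x) (principal S)) (\<lambda>y. ereal (f y))"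

section \<open>Smooth functions and their derivatives\<close>

definition dir_deriv :: "'a::euclidean_space \<Rightarrow> ('a \<Rightarrow> real) \<Rightarrow> 'a \<Rightarrow> real" where
  "dir_deriv v f x = frechet_derivative f (at x) v"

text \<open>Only used for open \<open>S\<close>.\<close>

primrec C_k_on :: "nat \<Rightarrow> 'a::euclidean_space set \<Rightarrow> ('a \<Rightarrow> real) \<Rightarrow> bool" where
  "C_k_on 0 S f \<longleftrightarrow> continuous_on S f"
| "C_k_on (Suc k) S f \<longleftrightarrow> f differentiable_on S \<and> (\<forall>v\<in>Basis. C_k_on k S (dir_deriv v f))"

definition smooth_on :: "'a::euclidean_space set \<Rightarrow> ('a \<Rightarrow> real) \<Rightarrow> bool" where
  "smooth_on S f \<longleftrightarrow> (\<forall>k. C_k_on k S f)"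

text \<open>Functions of \<open>(x, t)\<close>; gradient and Hessian are with respect to \<open>x\<close> only.\<close>

definition time_deriv :: "((real^'n) \<times> real \<Rightarrow> real) \<Rightarrow> (real^'n) \<times> real \<Rightarrow> real" where
  "time_deriv \<phi> z = dir_deriv (0, 1) \<phi> z"

definition space_grad :: "((real^'n) \<times> real \<Rightarrow> real) \<Rightarrow> (real^'n) \<times> real \<Rightarrow> real^'n" where
  "space_grad \<phi> z = (\<chi> i. dir_deriv (axis i 1, 0) \<phi> z)"

definition space_hess :: "((real^'n) \<times> real \<Rightarrow> real) \<Rightarrow> (real^'n) \<times> real \<Rightarrow> real^'n^'n" where
  "space_hess \<phi> z = (\<chi> i j. dir_deriv (axis i 1, 0) (dir_deriv (axis j 1, 0) \<phi>) z)"

section \<open>The mean curvature operator\<close>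

definition tensor :: "real^'n \<Rightarrow> real^'n \<Rightarrow> real^'n^'n" where
  "tensor p q = (\<chi> i j. p $ i * q $ j)"

definition mc_op :: "(real^'n) \<times> (real^'n^'n) \<Rightarrow> real" where
  "mc_op = (\<lambda>(p, X). - trace ((mat 1 - (1 / (norm p)\<^sup>2) *\<^sub>R tensor p p) ** X))"

definition mc_dom :: "((real^'n) \<times> (real^'n^'n)) set" where
  "mc_dom = {(p, X). p \<noteq> 0 \<and> transpose X = X}"

section \<open>The obstacle problem\<close>

definition spacetime :: "((real^'n) \<times> real) set" where
  "spacetime = UNIV \<times> {0..}"

definition spacetime_int :: "((real^'n) \<times> real) set" where
  "spacetime_int = UNIV \<times> {0<..}"

definition viscosity_subsolution ::
  "real \<Rightarrow> (real^'n \<Rightarrow> real) \<Rightarrow> (real^'n \<Rightarrow> real) \<Rightarrow> (real^'n \<Rightarrow> real) \<Rightarrow> ((real^'n) \<times> real \<Rightarrow> real) \<Rightarrow> bool"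
  where
  "viscosity_subsolution \<nu> \<Psi>m \<Psi>p u0 u \<longleftrightarrow>
     (let us = usc_envelope spacetime u in
       (\<forall>x. \<forall>t>0. ereal (\<Psi>m x) \<le> us (x, t) \<and> us (x, t) \<le> ereal (\<Psi>p x)) \<and>
       (\<forall>x. us (x, 0) \<le> ereal (u0 x)) \<and>
       (\<forall>\<phi> x0 t0. smooth_on spacetime_int \<phi> \<longrightarrow> t0 > 0 \<longrightarrow>
          (\<forall>\<^sub>F z in nhds (x0, t0). us z - ereal (\<phi> z) \<le> us (x0, t0) - ereal (\<phi> (x0, t0))) \<longrightarrow>
          us (x0, t0) > ereal (\<Psi>m x0) \<longrightarrow>
          ereal (time_deriv \<phi> (x0, t0) - \<nu> * norm (space_grad \<phi> (x0, t0)))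
            + lsc_envelope mc_dom mc_op (space_grad \<phi> (x0, t0), space_hess \<phi> (x0, t0)) \<le> 0))"

definition viscosity_supersolution ::
  "real \<Rightarrow> (real^'n \<Rightarrow> real) \<Rightarrow> (real^'n \<Rightarrow> real) \<Rightarrow> (real^'n \<Rightarrow> real) \<Rightarrow> ((real^'n) \<times> real \<Rightarrow> real) \<Rightarrow> bool"
  where
  "viscosity_supersolution \<nu> \<Psi>m \<Psi>p u0 u \<longleftrightarrow>
     (let us = lsc_envelope spacetime u in
       (\<forall>x. \<forall>t>0. ereal (\<Psi>m x) \<le> us (x, t) \<and> us (x, t) \<le> ereal (\<Psi>p x)) \<and>
       (\<forall>x. us (x, 0) \<ge> ereal (u0 x)) \<and>
       (\<forall>\<phi> x0 t0. smooth_on spacetime_int \<phi> \<longrightarrow> t0 > 0 \<longrightarrow>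
          (\<forall>\<^sub>F z in nhds (x0, t0). us z - ereal (\<phi> z) \<ge> us (x0, t0) - ereal (\<phi> (x0, t0))) \<longrightarrow>
          us (x0, t0) < ereal (\<Psi>p x0) \<longrightarrow>
          ereal (time_deriv \<phi> (x0, t0) - \<nu> * norm (space_grad \<phi> (x0, t0)))
            + usc_envelope mc_dom mc_op (space_grad \<phi> (x0, t0), space_hess \<phi> (x0, t0)) \<ge> 0))"

definition viscosity_solution ::
  "real \<Rightarrow> (real^'n \<Rightarrow> real) \<Rightarrow> (real^'n \<Rightarrow> real) \<Rightarrow> (real^'n \<Rightarrow> real) \<Rightarrow> ((real^'n) \<times> real \<Rightarrow> real) \<Rightarrow> bool"
  where
  "viscosity_solution \<nu> \<Psi>m \<Psi>p u0 u \<longleftrightarrow>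
     viscosity_subsolution \<nu> \<Psi>m \<Psi>p u0 u \<and> viscosity_supersolution \<nu> \<Psi>m \<Psi>p u0 u"

definition K_class :: "real \<Rightarrow> ((real^'n) \<times> real \<Rightarrow> real) set" where
  "K_class a = {u. continuous_on spacetime u \<and>
     (\<forall>T>0. \<exists>R>0. \<forall>x t. norm x \<ge> R \<longrightarrow> 0 \<le> t \<longrightarrow> t \<le> T \<longrightarrow> u (x, t) = a)}"

text \<open>Data and solution of the level set formulation. The constant \<open>a < 0\<close> is existentially
  quantified: multiplying \<open>\<Psi>m\<close>, \<open>\<Psi>p\<close>, \<open>u0\<close> and \<open>u\<close> by \<open>c > 0\<close> turns a solution in
  \<open>K_class a\<close> into one in \<open>K_class (c * a)\<close> with the same level sets at \<open>0\<close>, so its choice is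
  immaterial.\<close>

definition level_set_solution ::
  "real \<Rightarrow> (real^'n \<Rightarrow> real) \<Rightarrow> (real^'n \<Rightarrow> real) \<Rightarrow> ((real^'n) \<times> real \<Rightarrow> real) \<Rightarrow> bool" where
  "level_set_solution \<nu> \<Psi>m \<Psi>p u \<longleftrightarrow>
     (\<exists>L. L-lipschitz_on UNIV \<Psi>m) \<and> (\<exists>L. L-lipschitz_on UNIV \<Psi>p) \<and> (\<forall>x. \<Psi>m x \<le> \<Psi>p x) \<and>
     (\<exists>u0. continuous_on UNIV u0 \<and> viscosity_solution \<nu> \<Psi>m \<Psi>p u0 u) \<and>
     (\<exists>a<0. u \<in> K_class a)"

text \<open>\<open>D\<close> is indexed by all reals, but only the \<open>D t\<close> with \<open>t \<ge> 0\<close> matter.\<close>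

definition open_evolution ::
  "real \<Rightarrow> (real^'n) set \<Rightarrow> (real^'n) set \<Rightarrow> (real^'n) set \<Rightarrow> (real \<Rightarrow> (real^'n) set) \<Rightarrow> bool" where
  "open_evolution \<nu> D0 Om Op D \<longleftrightarrow>
     open D0 \<and> open Om \<and> open Op \<and> D 0 = D0 \<and>
     (\<forall>t\<ge>0. open (D t) \<and> Om \<subseteq> D t \<and> D t \<subseteq> Op) \<and>
     (\<exists>\<Psi>m \<Psi>p u. level_set_solution \<nu> \<Psi>m \<Psi>p u \<and>
        Om = {x. \<Psi>m x > 0} \<and> Op = {x. \<Psi>p x > 0} \<and>
        (\<forall>t\<ge>0. D t = {x. u (x, t) > 0}))"

definition closed_evolution ::
  "real \<Rightarrow> (real^'n) set \<Rightarrow> (real^'n) set \<Rightarrow> (real^'n) set \<Rightarrow> (real \<Rightarrow> (real^'n) set) \<Rightarrow> bool" where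
  "closed_evolution \<nu> E0 Cm Cp E \<longleftrightarrow>
     closed E0 \<and> closed Cm \<and> closed Cp \<and> E 0 = E0 \<and>
     (\<forall>t\<ge>0. closed (E t) \<and> Cm \<subseteq> E t \<and> E t \<subseteq> Cp) \<and>
     (\<exists>\<Psi>m \<Psi>p u. level_set_solution \<nu> \<Psi>m \<Psi>p u \<and>
        Cm = {x. \<Psi>m x \<ge> 0} \<and> Cp = {x. \<Psi>p x \<ge> 0} \<and>
        (\<forall>t\<ge>0. E t = {x. u (x, t) \<ge> 0}))"

section \<open>Set-theoretic limits as time tends to infinity\<close>

definition set_limsup :: "(real \<Rightarrow> 'a set) \<Rightarrow> 'a set" where
  "set_limsup D = (\<Inter>\<tau>\<in>{0<..}. \<Union>t\<in>{\<tau><..}. D t)"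

definition set_liminf :: "(real \<Rightarrow> 'a set) \<Rightarrow> 'a set" where
  "set_liminf D = (\<Union>\<tau>\<in>{0<..}. \<Inter>t\<in>{\<tau><..}. D t)"

end

theory Submission
  imports Defs "HOL-Real_Asymp.Real_Asymp"
begin

text \<open>
  A solution \<open>u\<close> is merely continuous, but the definition of a viscosity solution says what happens
  where \<open>u\<close> is touched by a smooth function, and explicit smooth functions of a single form suffice, namely
  \<open>c + H e\<^sup>l\<^sup>t + N e\<^sup>k\<^sup>s\<close>, where \<open>s (x, t) = \<bar>x - a - t b\<bar>\<^sup>2 - q t\<close> measures by how much \<open>x\<close> lies outside the
  sphere with centre \<open>a + t b\<close> and squared radius \<open>q t\<close>. For large \<open>\<bar>k\<bar>\<close> the last term is almost a
  step: it is close to \<open>0\<close> strictly on one side of the moving sphere, and at least \<open>N\<close> on the other. At a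
  point of contact the equation reads: time derivative of \<open>H e\<^sup>l\<^sup>t\<close>, plus a positive multiple of
  \<open>e\<^sup>k\<^sup>s\<close> times the difference between the velocity of the sphere and the velocity \<open>- \<kappa> + \<nu>\<close>
  prescribed by the flow. If this difference has a strict sign on the sphere, then it has this sign
  near the sphere, while away from the sphere \<open>e\<^sup>k\<^sup>s\<close> is negligible against the time derivative
  of \<open>H e\<^sup>l\<^sup>t\<close>. Hence no contact occurs, and the level set \<open>{u \<ge> c}\<close> or \<open>{u \<le> c}\<close> keeps containing
  the side of the sphere that it contained initially (\<open>barrier_comparison\<close>). Everything else is a
  choice of moving spheres.

  Let \<open>\<bar>x\<bar>\<^sub>1 = \<bar>x\<^sub>1\<bar> + \<bar>x\<^sub>2\<bar>\<close>. Because \<open>ball z r\<close> lies in the diamond \<open>O\<^sub>+ = {\<bar>x\<bar>\<^sub>1 < R}\<close> iff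
  \<open>\<bar>z\<bar>\<^sub>1 + \<surd>2 r \<le> R\<close>, the critical balls, those of radius \<open>1/\<nu>\<close>, fit into the diamond iff
  \<open>R \<ge> \<surd>2/\<nu>\<close>.

  \<^item> Lower bound. A ball of radius larger than \<open>1/\<nu>\<close> would grow under the flow, so it may instead be
    moved, slowly, anywhere inside the diamond. If \<open>R > \<surd>2/\<nu>\<close> then every point of \<open>A\<close> lies in a ball
    of radius slightly larger than \<open>1/\<nu>\<close> that fits into the diamond, and this ball is reached from
    the one inside \<open>D\<^sub>0\<close> at constant speed along a segment (\<open>supercritical_ball_travels\<close>). If
    \<open>R = \<surd>2/\<nu>\<close> then \<open>A\<close> is the critical ball at the origin; a ball that is slightly smaller does
    shrink, but its defect grows only exponentially in time and can be chosen arbitrarily small, so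
    that any point of \<open>A\<close> is still covered at any given time (\<open>critical_ball_persists\<close>).

  \<^item> Upper bound. In a corner of the diamond the set is confined to a ball of radius \<open>\<rho> < 1/\<nu>\<close> which
    is centred on a coordinate axis and whose boundary arc cuts off the corner. As such a ball would
    shrink under the flow, its arc may be pushed slowly towards the origin, as long as
    its endpoints stay on the sides of the diamond (\<open>corner_confinement\<close>). If \<open>R \<ge> \<surd>2/\<nu>\<close>, then in the
    limit \<open>\<rho> \<rightarrow> 1/\<nu>\<close> the arcs that touch the sides are those which round off the corners of \<open>A\<close>.
    If \<open>R < \<surd>2/\<nu>\<close>, then the four arcs can be pushed until they lie on one circle of radius less than \<open>1/\<nu>\<close> about the
    origin, and the ball bounded by it shrinks to a point (\<open>small_ball_vanishes\<close>).

  The open and the closed evolution differ only in the level \<open>c\<close>: for the lower bound, some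
  \<open>c > 0\<close> in the open and \<open>c = 0\<close> in the closed case; for the upper bound, \<open>c = 0\<close> in the open and some
  \<open>c < 0\<close> in the closed case.
\<close>

section \<open>Smooth functions on the whole space\<close>

lemma dir_deriv_eq: "(f has_derivative f') (at x) \<Longrightarrow> dir_deriv v f x = f' v"
  unfolding dir_deriv_def by (metis frechet_derivative_at)

text \<open>The derivatives in \<^const>\<open>C_k_on\<close> are taken in the whole space, so smoothness on the whole space
  restricts to subsets. All test functions below are smooth everywhere, and then the derivatives of sums,
  products and compositions are given by identities between functions, not just on a subset.\<close>

lemma C_k_on_mono:
  "C_k_on k UNIV f \<Longrightarrow> C_k_on k S f"
  by (induction k arbitrary: f) (auto intro: continuous_on_subset differentiable_on_subset)

lemma C_k_on_Suc_imp: "C_k_on (Suc k) S f \<Longrightarrow> C_k_on k S f"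
proof (induction k arbitrary: f)
  case 0
  then show ?case by (simp add: differentiable_imp_continuous_on)
next
  case (Suc k)
  then show ?case by (metis C_k_on.simps(2))
qed

lemma C_k_on_affine:
  assumes "bounded_linear L"
  shows "C_k_on k UNIV (\<lambda>x. L x + c)"
proof -
  have *: "C_k_on k UNIV (\<lambda>x::'a. c)" for k and c :: real
  proof (induction k arbitrary: c)
    case (Suc k)
    have "dir_deriv v (\<lambda>x::'a. c) = (\<lambda>x. 0)" for v
      by (rule ext, rule dir_deriv_eq[where f'="\<lambda>_. 0", simplified]) auto
    then show ?case using Suc by simp
  qed auto
  show ?thesis
  proof (cases k)
    case 0
    then show ?thesis using assms by (simp add: continuous_on_add linear_continuous_on)
  next
    case (Suc j)
    have d: "((\<lambda>x. L x + c) has_derivative L) (at x)" for x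
      using bounded_linear_imp_has_derivative[OF assms] by (auto intro!: derivative_eq_intros)
    then have "dir_deriv v (\<lambda>x. L x + c) = (\<lambda>x. L v)" for v
      by (intro ext dir_deriv_eq)
    moreover have "(\<lambda>x. L x + c) differentiable_on UNIV"
      using d by (auto simp: differentiable_on_def differentiable_def)
    ultimately show ?thesis using Suc * by simp
  qed
qed

lemma C_k_on_add:
  "C_k_on k UNIV f \<Longrightarrow> C_k_on k UNIV g \<Longrightarrow> C_k_on k UNIV (\<lambda>x. f x + g x)"
proof (induction k arbitrary: f g)
  case 0
  then show ?case by (auto intro!: continuous_intros)
next
  case (Suc k)
  have "dir_deriv v (\<lambda>x. f x + g x) = (\<lambda>x. dir_deriv v f x + dir_deriv v g x)" for v
  proof
    fix x
    have "(f has_derivative frechet_derivative f (at x)) (at x)"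
      "(g has_derivative frechet_derivative g (at x)) (at x)"
      using Suc.prems by (auto simp: differentiable_on_def frechet_derivative_works)
    from has_derivative_add[OF this]
    show "dir_deriv v (\<lambda>x. f x + g x) x = dir_deriv v f x + dir_deriv v g x"
      by (simp add: dir_deriv_eq) (simp add: dir_deriv_def)
  qed
  then show ?case using Suc by (auto intro!: differentiable_on_add)
qed

lemma C_k_on_mult:
  "C_k_on k UNIV f \<Longrightarrow> C_k_on k UNIV g \<Longrightarrow> C_k_on k UNIV (\<lambda>x. f x * g x)"
proof (induction k arbitrary: f g)
  case 0
  then show ?case by (auto intro!: continuous_intros)
next
  case (Suc k)
  have "dir_deriv v (\<lambda>x. f x * g x) = (\<lambda>x. f x * dir_deriv v g x + dir_deriv v f x * g x)" for v
  proof
    fix x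
    have "(f has_derivative frechet_derivative f (at x)) (at x)"
      "(g has_derivative frechet_derivative g (at x)) (at x)"
      using Suc.prems by (auto simp: differentiable_on_def frechet_derivative_works)
    from has_derivative_mult[OF this]
    show "dir_deriv v (\<lambda>x. f x * g x) x = f x * dir_deriv v g x + dir_deriv v f x * g x"
      by (simp add: dir_deriv_eq) (simp add: dir_deriv_def)
  qed
  moreover have "C_k_on k UNIV f" "C_k_on k UNIV g"
    using Suc.prems by (blast intro: C_k_on_Suc_imp)+
  ultimately show ?case using Suc by (auto intro!: differentiable_on_mult C_k_on_add)
qed

lemma C_k_on_exp:
  "C_k_on k UNIV f \<Longrightarrow> C_k_on k UNIV (\<lambda>x. exp (f x))"
proof (induction k arbitrary: f)
  case 0
  then show ?case by (auto intro!: continuous_intros)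
next
  case (Suc k)
  have d: "((\<lambda>x. exp (f x)) has_derivative (\<lambda>v. exp (f x) * frechet_derivative f (at x) v)) (at x)" for x
  proof -
    have "(f has_derivative frechet_derivative f (at x)) (at x)"
      using Suc.prems by (auto simp: differentiable_on_def frechet_derivative_works)
    from has_derivative_exp[OF this] show ?thesis by (simp add: mult.commute)
  qed
  have "dir_deriv v (\<lambda>x. exp (f x)) = (\<lambda>x. exp (f x) * dir_deriv v f x)" for v
    by (rule ext, subst dir_deriv_eq[OF d]) (simp add: dir_deriv_def)
  moreover have "(\<lambda>x. exp (f x)) differentiable_on UNIV"
    using d by (auto simp: differentiable_on_def differentiable_def)
  ultimately show ?case using Suc C_k_on_Suc_imp[of k UNIV f] by (auto intro!: C_k_on_mult)
qed

lemma C_k_on_snd: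
  fixes q :: "real \<Rightarrow> real"
  shows "C_k_on k UNIV q \<Longrightarrow> C_k_on k UNIV (\<lambda>z::'a::euclidean_space \<times> real. q (snd z))"
proof (induction k arbitrary: q)
  case 0
  then show ?case
    by (auto intro!: continuous_on_compose2[of UNIV q] continuous_intros)
next
  case (Suc k)
  have d: "((\<lambda>z::'a \<times> real. q (snd z)) has_derivative (\<lambda>v. snd v * dir_deriv 1 q (snd z))) (at z)" for z
  proof -
    have q: "(q has_derivative frechet_derivative q (at (snd z))) (at (snd z))"
      using Suc.prems by (auto simp: differentiable_on_def frechet_derivative_works)
    have "frechet_derivative q (at (snd z)) = (\<lambda>r. r * dir_deriv 1 q (snd z))"
    proof
      fix r
      show "frechet_derivative q (at (snd z)) r = r * dir_deriv 1 q (snd z)"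
        unfolding dir_deriv_def using linear_cmul[OF has_derivative_linear[OF q], of r 1]
        by (metis mult.right_neutral real_scaleR_def)
    qed
    with q have "(q has_derivative (\<lambda>r. r * dir_deriv 1 q (snd z))) (at (snd z))"
      by simp
    from has_derivative_compose[OF has_derivative_snd[OF has_derivative_ident] this]
    show ?thesis .
  qed
  have "dir_deriv v (\<lambda>z::'a \<times> real. q (snd z)) = (\<lambda>z. snd v * dir_deriv 1 q (snd z))" for v
    by (rule ext) (rule dir_deriv_eq[OF d])
  moreover have "(\<lambda>z::'a \<times> real. q (snd z)) differentiable_on UNIV"
    using d by (auto simp: differentiable_on_def differentiable_def)
  moreover have "C_k_on k UNIV (\<lambda>z::'a \<times> real. dir_deriv 1 q (snd z))"
    using Suc by auto
  moreover have "C_k_on k UNIV (\<lambda>z::'a \<times> real. c)" for c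
    using C_k_on_affine[OF bounded_linear_zero, where c=c] by simp
  ultimately show ?case by (auto intro!: C_k_on_mult)
qed

lemma smooth_on_intros:
  shows smooth_on_affine: "bounded_linear L \<Longrightarrow> smooth_on UNIV (\<lambda>x. L x + c)"
    and smooth_on_add: "smooth_on UNIV f \<Longrightarrow> smooth_on UNIV g \<Longrightarrow> smooth_on UNIV (\<lambda>x. f x + g x)"
    and smooth_on_mult: "smooth_on UNIV f \<Longrightarrow> smooth_on UNIV g \<Longrightarrow> smooth_on UNIV (\<lambda>x. f x * g x)"
    and smooth_on_exp: "smooth_on UNIV f \<Longrightarrow> smooth_on UNIV (\<lambda>x. exp (f x))"
  by (auto simp: smooth_on_def intro: C_k_on_affine C_k_on_add C_k_on_mult C_k_on_exp)

lemma smooth_on_snd: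
  fixes q :: "real \<Rightarrow> real"
  shows "smooth_on UNIV q \<Longrightarrow> smooth_on UNIV (\<lambda>z::'a::euclidean_space \<times> real. q (snd z))"
  by (auto simp: smooth_on_def intro: C_k_on_snd)

lemma smooth_on_const: "smooth_on UNIV (\<lambda>x::'a::euclidean_space. c)"
  using smooth_on_affine[OF bounded_linear_zero, of c] by simp

lemma smooth_on_sum:
  "finite I \<Longrightarrow> (\<And>i. i \<in> I \<Longrightarrow> smooth_on UNIV (f i)) \<Longrightarrow> smooth_on UNIV (\<lambda>x. \<Sum>i\<in>I. f i x)"
  by (induction rule: finite_induct) (auto intro: smooth_on_const smooth_on_add)

section \<open>The mean curvature operator at radial Hessians\<close>

lemma trace_tensor: "trace (tensor w w) = (norm w)\<^sup>2"
  by (simp add: trace_def tensor_def power2_norm_eq_inner inner_vec_def)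

lemma trace_scaleR_vec: "trace (r *\<^sub>R (A::real^'n^'n)) = r * trace A"
  by (simp add: trace_def sum_distrib_left)

lemma tensor_mult_vec: "tensor w w *v p = (w \<bullet> p) *\<^sub>R w"
  by (simp add: vec_eq_iff tensor_def matrix_vector_mult_def inner_vec_def sum_distrib_left
      sum_distrib_right mult_ac)

lemma mc_op_eq:
  fixes X :: "real^'a^'a"
  shows "mc_op (p, X) = (p \<bullet> (X *v p)) / (norm p)\<^sup>2 - trace X"
proof -
  have "trace (tensor p p ** X) = p \<bullet> (X *v p)"
    by (simp add: trace_def matrix_matrix_mult_def tensor_def inner_vec_def
        matrix_vector_mult_def sum_distrib_left) (subst sum.swap, simp add: mult_ac)
  moreover have "(mat 1 - r *\<^sub>R tensor p p) ** X = X - r *\<^sub>R (tensor p p ** X)" for r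
  proof -
    have "(A - r *\<^sub>R B) ** X = A ** X - r *\<^sub>R (B ** X)" for A B :: "real^'a^'a"
      by (simp add: vec_eq_iff matrix_matrix_mult_def left_diff_distrib sum_subtractf
          sum_distrib_left mult.assoc)
    then show ?thesis by (simp add: matrix_mul_lid)
  qed
  ultimately show ?thesis
    by (simp add: mc_op_def trace_sub trace_scaleR_vec)
qed

text \<open>This bound on the Rayleigh quotient does not depend on \<open>p\<close>. Therefore the curvature operator is
  continuous in \<open>X\<close> uniformly in \<open>p\<close>, up to the singularity \<open>p = 0\<close>.\<close>

lemma rayleigh_bound:
  fixes Y :: "real^'n^'n"
  shows "norm (p \<bullet> (Y *v p) / (norm p)\<^sup>2) \<le> (\<Sum>i\<in>UNIV. \<Sum>j\<in>UNIV. \<bar>Y $ i $ j\<bar>)"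
proof (cases "p = 0")
  case True
  then show ?thesis by (simp add: sum_nonneg)
next
  case False
  have "\<bar>p \<bullet> (Y *v p)\<bar> = \<bar>\<Sum>i\<in>UNIV. \<Sum>j\<in>UNIV. p $ i * Y $ i $ j * p $ j\<bar>"
    by (simp add: inner_vec_def matrix_vector_mult_def sum_distrib_left mult_ac)
  also have "\<dots> \<le> (\<Sum>i\<in>UNIV. \<Sum>j\<in>UNIV. \<bar>p $ i * Y $ i $ j * p $ j\<bar>)"
    by (intro order_trans[OF sum_abs] sum_mono order_refl)
  also have "\<dots> \<le> (\<Sum>i\<in>UNIV. \<Sum>j\<in>UNIV. \<bar>Y $ i $ j\<bar> * (norm p)\<^sup>2)"
  proof (intro sum_mono)
    fix i j
    have "\<bar>p $ i\<bar> * \<bar>p $ j\<bar> \<le> norm p * norm p"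
      by (intro mult_mono component_le_norm_cart) auto
    from mult_left_mono[OF this, of "\<bar>Y $ i $ j\<bar>"]
    show "\<bar>p $ i * Y $ i $ j * p $ j\<bar> \<le> \<bar>Y $ i $ j\<bar> * (norm p)\<^sup>2"
      by (simp add: abs_mult power2_eq_square mult_ac)
  qed
  finally show ?thesis
    using False by (simp add: divide_le_eq sum_distrib_right)
qed

text \<open>The gradient and the Hessian of a radial function at the point \<open>w\<close> are of the form considered here.
  The projection onto the complement of \<open>w\<close> removes the second part of the Hessian, which leaves the
  curvature term. At \<open>w = 0\<close> the gradient vanishes and \<open>p / norm p\<close> has no limit; but there the
  Hessian is a multiple of the identity, whose trace on the complement of \<open>p\<close> is the same for all
  \<open>p\<close>. This is why the singularity of the operator causes no trouble at the centres of the spheres.\<close>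

lemma mc_op_tendsto:
  fixes w :: "real^'n"
  assumes "\<alpha> \<noteq> 0"
  shows "(mc_op \<longlongrightarrow> - \<alpha> * (real CARD('n) - 1))
           (inf (nhds (\<alpha> *\<^sub>R w, \<alpha> *\<^sub>R mat 1 + \<beta> *\<^sub>R tensor w w)) (principal mc_dom))"
proof -
  define X0 :: "real^'n^'n" where "X0 = \<alpha> *\<^sub>R mat 1 + \<beta> *\<^sub>R tensor w w"
  define F where "F = inf (nhds (\<alpha> *\<^sub>R w, X0)) (principal mc_dom)"
  define G where "G = (\<lambda>(p::real^'n, X::real^'n^'n).
      \<alpha> + \<beta> * ((w \<bullet> p)\<^sup>2 / (norm p)\<^sup>2) + (p \<bullet> ((X - X0) *v p)) / (norm p)\<^sup>2 - trace X)"
  have lim: "(fst \<longlongrightarrow> \<alpha> *\<^sub>R w) F" "(snd \<longlongrightarrow> X0) F"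
  proof -
    have "((\<lambda>z. z) \<longlongrightarrow> (\<alpha> *\<^sub>R w, X0)) F"
      unfolding F_def filterlim_def by simp
    from tendsto_fst[OF this] tendsto_snd[OF this]
    show "(fst \<longlongrightarrow> \<alpha> *\<^sub>R w) F" "(snd \<longlongrightarrow> X0) F" by simp_all
  qed
  have "((\<lambda>z. \<Sum>i\<in>UNIV. \<Sum>j\<in>UNIV. \<bar>(snd z - X0) $ i $ j\<bar>)
      \<longlongrightarrow> (\<Sum>i\<in>UNIV. \<Sum>j\<in>UNIV. \<bar>(X0 - X0) $ i $ j\<bar>)) F"
    by (intro tendsto_intros lim)
  then have "((\<lambda>z. \<Sum>i\<in>UNIV. \<Sum>j\<in>UNIV. \<bar>(snd z - X0) $ i $ j\<bar>) \<longlongrightarrow> 0) F"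
    by simp
  note null = this
  have "norm ((fst z \<bullet> ((snd z - X0) *v fst z)) / (norm (fst z))\<^sup>2)
      \<le> (\<Sum>i\<in>UNIV. \<Sum>j\<in>UNIV. \<bar>(snd z - X0) $ i $ j\<bar>)" for z
    by (rule rayleigh_bound)
  then have 1: "((\<lambda>z. (fst z \<bullet> ((snd z - X0) *v fst z)) / (norm (fst z))\<^sup>2) \<longlongrightarrow> 0) F"
    by (intro Lim_null_comparison[OF _ null] always_eventually allI)
  have 2: "((\<lambda>z. (w \<bullet> fst z)\<^sup>2 / (norm (fst z))\<^sup>2) \<longlongrightarrow> (norm w)\<^sup>2) F"
  proof (cases "w = 0")
    case False
    have "((\<lambda>z. (w \<bullet> fst z)\<^sup>2 / (norm (fst z))\<^sup>2) \<longlongrightarrow> (w \<bullet> (\<alpha> *\<^sub>R w))\<^sup>2 / (norm (\<alpha> *\<^sub>R w))\<^sup>2) F"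
      using False assms by (intro tendsto_intros lim) auto
    also have "(w \<bullet> (\<alpha> *\<^sub>R w))\<^sup>2 / (norm (\<alpha> *\<^sub>R w))\<^sup>2 = (norm w)\<^sup>2"
      using False assms by (simp add: power2_norm_eq_inner[symmetric] power_mult_distrib)
        (simp add: power2_eq_square power4_eq_xxxx)
    finally show ?thesis .
  qed simp
  have 3: "((\<lambda>z. trace (snd z)) \<longlongrightarrow> trace X0) F"
    unfolding trace_def by (intro tendsto_intros lim)
  have "((\<lambda>z. \<alpha> + \<beta> * ((w \<bullet> fst z)\<^sup>2 / (norm (fst z))\<^sup>2)
      + (fst z \<bullet> ((snd z - X0) *v fst z)) / (norm (fst z))\<^sup>2 - trace (snd z))
      \<longlongrightarrow> \<alpha> + \<beta> * (norm w)\<^sup>2 + 0 - trace X0) F"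
    by (intro tendsto_intros 1 2 3)
  also have "\<alpha> + \<beta> * (norm w)\<^sup>2 + 0 - trace X0 = - \<alpha> * (real CARD('n) - 1)"
    by (simp add: X0_def trace_add trace_scaleR_vec trace_tensor trace_I algebra_simps)
  finally have "(G \<longlongrightarrow> - \<alpha> * (real CARD('n) - 1)) F"
    by (simp add: G_def case_prod_unfold)
  moreover have "eventually (\<lambda>z. mc_op z = G z) F"
  proof -
    have "mc_op (p, X) = G (p, X)" if "p \<noteq> 0" for p X
    proof -
      have "X *v p = (X - X0) *v p + X0 *v p"
        by (simp add: matrix_vector_mult_diff_rdistrib)
      also have "X0 *v p = \<alpha> *\<^sub>R p + (\<beta> * (w \<bullet> p)) *\<^sub>R w"
        by (simp add: X0_def matrix_vector_mult_add_rdistrib tensor_mult_vec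
            scaleR_matrix_vector_assoc[symmetric])
      finally have "p \<bullet> (X *v p) = p \<bullet> ((X - X0) *v p) + \<alpha> * (norm p)\<^sup>2 + \<beta> * (w \<bullet> p)\<^sup>2"
        by (simp add: inner_add_right dot_square_norm inner_commute power2_eq_square[of "p \<bullet> w"])
      then show ?thesis
        using that by (simp add: mc_op_eq G_def add_divide_distrib)
    qed
    then have "mc_op z = G z" if "z \<in> mc_dom" for z
      using that unfolding mc_dom_def by blast
    then show ?thesis
      unfolding F_def eventually_inf_principal by simp
  qed
  ultimately have "(mc_op \<longlongrightarrow> - \<alpha> * (real CARD('n) - 1)) F"
    using tendsto_cong[of mc_op G F] by blast
  then show ?thesis
    unfolding F_def X0_def .
qed

lemma lsc_envelope_mc_op_ge:
  fixes w :: "real^'n"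
  assumes "\<alpha> \<noteq> 0"
  shows "ereal (- \<alpha> * (real CARD('n) - 1))
           \<le> lsc_envelope mc_dom mc_op (\<alpha> *\<^sub>R w, \<alpha> *\<^sub>R mat 1 + \<beta> *\<^sub>R tensor w w)"
  unfolding lsc_envelope_def le_Liminf_iff
proof (intro allI impI)
  fix y assume "y < ereal (- \<alpha> * (real CARD('n) - 1))"
  then show "\<forall>\<^sub>F z in inf (nhds (\<alpha> *\<^sub>R w, \<alpha> *\<^sub>R mat 1 + \<beta> *\<^sub>R tensor w w)) (principal mc_dom). y < ereal (mc_op z)"
    using order_tendstoD(1)[OF tendsto_ereal[OF mc_op_tendsto[OF assms, of w \<beta>]]] by blast
qed

lemma usc_envelope_mc_op_le:
  fixes w :: "real^'n"
  assumes "\<alpha> \<noteq> 0"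
  shows "usc_envelope mc_dom mc_op (\<alpha> *\<^sub>R w, \<alpha> *\<^sub>R mat 1 + \<beta> *\<^sub>R tensor w w)
           \<le> ereal (- \<alpha> * (real CARD('n) - 1))"
  unfolding usc_envelope_def Limsup_le_iff
proof (intro allI impI)
  fix y assume "y > ereal (- \<alpha> * (real CARD('n) - 1))"
  then show "\<forall>\<^sub>F z in inf (nhds (\<alpha> *\<^sub>R w, \<alpha> *\<^sub>R mat 1 + \<beta> *\<^sub>R tensor w w)) (principal mc_dom). y > ereal (mc_op z)"
    using order_tendstoD(2)[OF tendsto_ereal[OF mc_op_tendsto[OF assms, of w \<beta>]]] by blast
qed

section \<open>Barriers built from moving spheres\<close>

text \<open>The sphere has centre \<open>a + t b\<close> and squared radius \<open>q t\<close>. It is \<open>q\<close> and not the radius that is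
  prescribed, since a negative \<open>q\<close> represents a sphere that has already vanished.\<close>

definition sphere_excess ::
  "real^'n \<Rightarrow> real^'n \<Rightarrow> (real \<Rightarrow> real) \<Rightarrow> (real^'n) \<times> real \<Rightarrow> real" where
  "sphere_excess a b q z = (norm (fst z - a - snd z *\<^sub>R b))\<^sup>2 - q (snd z)"

text \<open>With \<open>N\<close> and \<open>k\<close> of either sign this covers upper and lower barriers, and spheres that bound a
  region from the inside or from the outside.\<close>

definition barrier ::
  "real \<Rightarrow> real \<Rightarrow> real \<Rightarrow> real \<Rightarrow> real \<Rightarrow> real^'n \<Rightarrow> real^'n \<Rightarrow> (real \<Rightarrow> real) \<Rightarrow> (real^'n) \<times> real \<Rightarrow> real" where
  "barrier c H l N k a b q z = c + H * exp (l * snd z) + N * exp (k * sphere_excess a b q z)"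

lemma smooth_on_barrier:
  fixes a b :: "real^'n"
  assumes "smooth_on UNIV q"
  shows "smooth_on UNIV (barrier c H l N k a b q)"
proof -
  have comp: "smooth_on UNIV (\<lambda>z::(real^'n) \<times> real. (fst z - a - snd z *\<^sub>R b) $ i)" for i
  proof -
    have "bounded_linear (\<lambda>z::(real^'n) \<times> real. (fst z - snd z *\<^sub>R b) $ i)"
      by (rule bounded_linear_compose[OF bounded_linear_vec_nth])
        (intro bounded_linear_sub bounded_linear_fst bounded_linear_snd bounded_linear_scaleR_const)
    from smooth_on_affine[OF this, of "- a $ i"] show ?thesis by (simp add: algebra_simps)
  qed
  have "smooth_on UNIV (\<lambda>z::(real^'n) \<times> real.
      (\<Sum>i\<in>UNIV. (fst z - a - snd z *\<^sub>R b) $ i * (fst z - a - snd z *\<^sub>R b) $ i) + (-1) * q (snd z))"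
    by (intro smooth_on_intros smooth_on_sum smooth_on_snd smooth_on_const comp assms finite)
  also have "(\<lambda>z. (\<Sum>i\<in>UNIV. (fst z - a - snd z *\<^sub>R b) $ i * (fst z - a - snd z *\<^sub>R b) $ i)
      + (-1) * q (snd z)) = sphere_excess a b q"
    by (rule ext) (simp add: sphere_excess_def power2_norm_eq_inner inner_vec_def)
  finally have s: "smooth_on UNIV (sphere_excess a b q)" .
  have "smooth_on UNIV (\<lambda>z::(real^'n) \<times> real. snd z)"
    using smooth_on_affine[OF bounded_linear_snd, of 0] by simp
  then show ?thesis
    unfolding barrier_def by (intro smooth_on_intros smooth_on_const s)
qed

lemma smooth_on_UNIV_subset: "smooth_on UNIV f \<Longrightarrow> smooth_on S f"
  by (auto simp: smooth_on_def intro: C_k_on_mono)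

lemma has_derivative_sphere_excess:
  fixes a b x :: "real^'a"
  assumes "(q has_real_derivative q') (at t)"
  shows "(sphere_excess a b q has_derivative
           (\<lambda>h. 2 * ((x - a - t *\<^sub>R b) \<bullet> (fst h - snd h *\<^sub>R b)) - q' * snd h)) (at (x, t))"
proof -
  have q: "(q has_derivative (\<lambda>h. q' * h)) (at (snd (x, t)))"
    using assms by (simp add: has_field_derivative_def)
  have qs: "((\<lambda>z::(real^'a) \<times> real. q (snd z)) has_derivative (\<lambda>h. q' * snd h)) (at (x, t))"
    by (rule has_derivative_compose[OF has_derivative_snd[OF has_derivative_ident] q])
  show ?thesis
    unfolding sphere_excess_def[abs_def] power2_norm_eq_inner
    by (rule has_derivative_eq_rhs,
        (rule derivative_intros qs)+)
      (auto simp: fun_eq_iff inner_commute algebra_simps)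
qed

lemma has_derivative_barrier:
  assumes "(q has_real_derivative q') (at t)"
  shows "(barrier c H l N k a b q has_derivative
           (\<lambda>h. H * l * exp (l * t) * snd h + N * k * exp (k * sphere_excess a b q (x, t)) *
              (2 * ((x - a - t *\<^sub>R b) \<bullet> (fst h - snd h *\<^sub>R b)) - q' * snd h))) (at (x, t))"
  unfolding barrier_def[abs_def]
  by (rule has_derivative_eq_rhs,
      (rule derivative_intros has_derivative_sphere_excess[OF assms])+)
    (auto simp: fun_eq_iff algebra_simps)

lemma barrier_derivatives:
  fixes a b x :: "real^'n" and t k :: real
  assumes q: "\<And>t. (q has_real_derivative q' t) (at t)"
  defines "w \<equiv> x - a - t *\<^sub>R b" and "e \<equiv> exp (k * sphere_excess a b q (x, t))"
  shows time_deriv_barrier: "time_deriv (barrier c H l N k a b q) (x, t)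
           = H * l * exp (l * t) - N * k * e * (2 * (w \<bullet> b) + q' t)"
    and space_grad_barrier: "space_grad (barrier c H l N k a b q) (x, t) = (2 * N * k * e) *\<^sub>R w"
    and space_hess_barrier: "space_hess (barrier c H l N k a b q) (x, t)
           = (2 * N * k * e) *\<^sub>R mat 1 + (4 * N * k\<^sup>2 * e) *\<^sub>R tensor w w"
proof -
  note d = has_derivative_barrier[OF q, THEN dir_deriv_eq]
  show "time_deriv (barrier c H l N k a b q) (x, t)
           = H * l * exp (l * t) - N * k * e * (2 * (w \<bullet> b) + q' t)"
    by (simp add: time_deriv_def d w_def e_def algebra_simps)
  show "space_grad (barrier c H l N k a b q) (x, t) = (2 * N * k * e) *\<^sub>R w"
    by (simp add: vec_eq_iff space_grad_def d w_def e_def inner_axis)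
  have 1: "dir_deriv (axis j 1, 0) (barrier c H l N k a b q) =
      (\<lambda>z. 2 * N * k * exp (k * sphere_excess a b q z) * ((fst z - a - snd z *\<^sub>R b) $ j))" for j
  proof
    fix z :: "(real^'n) \<times> real"
    show "dir_deriv (axis j 1, 0) (barrier c H l N k a b q) z =
      2 * N * k * exp (k * sphere_excess a b q z) * ((fst z - a - snd z *\<^sub>R b) $ j)"
      by (cases z) (simp add: d inner_axis)
  qed
  have "((\<lambda>z. 2 * N * k * exp (k * sphere_excess a b q z) * ((fst z - a - snd z *\<^sub>R b) $ j))
      has_derivative (\<lambda>h. 2 * N * k * e * (fst h - snd h *\<^sub>R b) $ j
        + 2 * N * k * (e * k * (2 * (w \<bullet> (fst h - snd h *\<^sub>R b)) - q' t * snd h)) * w $ j)) (at (x, t))" for j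
    unfolding w_def e_def
    by (rule has_derivative_eq_rhs,
      (rule derivative_intros has_derivative_sphere_excess[OF q] 
         bounded_linear.has_derivative[OF bounded_linear_vec_nth])+)
    (auto simp: fun_eq_iff algebra_simps)
  note d2 = dir_deriv_eq[OF this]
  have 2: "dir_deriv (axis i 1, 0)
        (\<lambda>z. 2 * N * k * exp (k * sphere_excess a b q z) * ((fst z - a - snd z *\<^sub>R b) $ j)) (x, t)
      = 2 * N * k * e * (if i = j then 1 else 0) + 4 * N * k\<^sup>2 * e * (w $ i * w $ j)" for i j
  proof -
    have "axis i (1::real) $ j = (if i = j then 1 else 0)"
      by (simp add: axis_def)
    then show ?thesis
      by (subst d2) (simp add: inner_axis power2_eq_square)
  qed
  show "space_hess (barrier c H l N k a b q) (x, t)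
           = (2 * N * k * e) *\<^sub>R mat 1 + (4 * N * k\<^sup>2 * e) *\<^sub>R tensor w w"
    unfolding space_hess_def 1 2 by (simp add: vec_eq_iff tensor_def mat_def)
qed

section \<open>Contact of barriers with viscosity solutions\<close>

text \<open>The inequality that a viscosity subsolution satisfies where a barrier touches it from above, with
  the derivatives of the barrier evaluated. The common factor \<open>2 exp (k s)\<close> is pulled out of the velocity
  of the sphere, its curvature and the driving term. For a supersolution \<open>u\<close> the same inequality
  holds for \<open>- u\<close> and \<open>- \<nu>\<close>, so that one comparison argument serves both.\<close>

definition barrier_subsolution ::
  "real \<Rightarrow> (real^'n \<Rightarrow> real) \<Rightarrow> ((real^'n) \<times> real \<Rightarrow> real) \<Rightarrow> bool" where
  "barrier_subsolution \<nu> \<Psi> v \<longleftrightarrow>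
     (\<forall>c H l N k a b q q' x t.
        N * k \<noteq> 0 \<longrightarrow> smooth_on UNIV q \<longrightarrow> (\<forall>t. (q has_real_derivative q' t) (at t)) \<longrightarrow> t > 0 \<longrightarrow>
        (\<forall>\<^sub>F z in nhds (x, t). v z - barrier c H l N k a b q z \<le> v (x, t) - barrier c H l N k a b q (x, t)) \<longrightarrow>
        \<Psi> x < v (x, t) \<longrightarrow>
        H * l * exp (l * t)
          + 2 * exp (k * sphere_excess a b q (x, t))
              * (N * k * (- ((x - a - t *\<^sub>R b) \<bullet> b) - q' t / 2 - (real CARD('n) - 1))
                 - \<nu> * \<bar>N * k\<bar> * norm (x - a - t *\<^sub>R b)) \<le> 0)"

lemma nhds_inf_principal_neq_bot:
  assumes "z \<in> S"
  shows "inf (nhds z) (principal S) \<noteq> bot"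
  using assms eventually_nhds_x_imp_x[of "\<lambda>x. x \<notin> S" z]
  by (auto simp: trivial_limit_def eventually_inf_principal)

lemma tendsto_inf_nhds_principal:
  assumes "continuous_on S f" "z \<in> S"
  shows "(f \<longlongrightarrow> f z) (inf (nhds z) (principal S))"
proof (rule topological_tendstoI)
  fix T assume T: "open T" "f z \<in> T"
  with assms obtain A where "open A" "z \<in> A" "\<And>y. y \<in> S \<Longrightarrow> y \<in> A \<Longrightarrow> f y \<in> T"
    unfolding continuous_on_topological by metis
  then show "\<forall>\<^sub>F x in inf (nhds z) (principal S). f x \<in> T"
    unfolding eventually_inf_principal eventually_nhds by blast
qed

lemma envelope_eq:
  assumes "continuous_on S f" "z \<in> S"
  shows usc_envelope_eq: "usc_envelope S f z = ereal (f z)"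
    and lsc_envelope_eq: "lsc_envelope S f z = ereal (f z)"
  unfolding usc_envelope_def lsc_envelope_def
  using tendsto_ereal[OF tendsto_inf_nhds_principal[OF assms]] nhds_inf_principal_neq_bot[OF assms(2)]
  by (auto intro: lim_imp_Limsup lim_imp_Liminf)

lemma eventually_spacetime_nhds:
  "t > 0 \<Longrightarrow> eventually (\<lambda>z. z \<in> spacetime) (nhds (x, t))"
  unfolding eventually_nhds
  by (rule exI[of _ "UNIV \<times> {0<..}"]) (auto simp: spacetime_def intro: open_Times)

lemma viscosity_subsolution_imp_barrier_subsolution:
  assumes sub: "viscosity_subsolution \<nu> \<Psi>m \<Psi>p u0 u" and cont: "continuous_on spacetime u"
  shows "barrier_subsolution \<nu> \<Psi>m u"
  unfolding barrier_subsolution_def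
proof (intro allI impI)
  fix c H l N k :: real and a b :: "real^'a" and q q' x t
  assume Nk: "N * k \<noteq> 0" and q: "smooth_on UNIV q" "\<forall>t. (q has_real_derivative q' t) (at t)"
    and t: "t > 0" and max: "\<forall>\<^sub>F z in nhds (x, t).
      u z - barrier c H l N k a b q z \<le> u (x, t) - barrier c H l N k a b q (x, t)"
    and obst: "\<Psi>m x < u (x, t)"
  define \<phi> where "\<phi> = barrier c H l N k a b q"
  define us where "us = usc_envelope spacetime u"
  define w where "w = x - a - t *\<^sub>R b"
  define e where "e = exp (k * sphere_excess a b q (x, t))"
  define \<alpha> where "\<alpha> = 2 * N * k * e"
  have us: "us z = ereal (u z)" if "z \<in> spacetime" for z
    unfolding us_def using usc_envelope_eq[OF cont that] .
  have xt: "(x, t) \<in> spacetime" using t by (simp add: spacetime_def)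
  have smooth: "smooth_on spacetime_int \<phi>"
    unfolding \<phi>_def by (rule smooth_on_UNIV_subset[OF smooth_on_barrier[OF q(1)]])
  have "\<forall>\<^sub>F z in nhds (x, t). us z - ereal (\<phi> z) \<le> us (x, t) - ereal (\<phi> (x, t))"
    using max eventually_spacetime_nhds[OF t, of x]
    by eventually_elim (simp add: us xt \<phi>_def)
  with sub smooth t obst have *:
    "ereal (time_deriv \<phi> (x, t) - \<nu> * norm (space_grad \<phi> (x, t)))
       + lsc_envelope mc_dom mc_op (space_grad \<phi> (x, t), space_hess \<phi> (x, t)) \<le> 0"
    unfolding viscosity_subsolution_def Let_def us_def[symmetric] by (simp add: us xt)
  have \<alpha>: "\<alpha> \<noteq> 0" using Nk by (simp add: \<alpha>_def e_def)
  have grad: "space_grad \<phi> (x, t) = \<alpha> *\<^sub>R w"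
    and hess: "space_hess \<phi> (x, t) = \<alpha> *\<^sub>R mat 1 + (4 * N * k\<^sup>2 * e) *\<^sub>R tensor w w"
    and time: "time_deriv \<phi> (x, t) = H * l * exp (l * t) - N * k * e * (2 * (w \<bullet> b) + q' t)"
    unfolding \<phi>_def \<alpha>_def w_def e_def
    by (rule barrier_derivatives[OF q(2)[rule_format]])+
  have "ereal (time_deriv \<phi> (x, t) - \<nu> * norm (space_grad \<phi> (x, t))) + ereal (- \<alpha> * (real CARD('a) - 1)) \<le>
     ereal (time_deriv \<phi> (x, t) - \<nu> * norm (space_grad \<phi> (x, t)))
       + lsc_envelope mc_dom mc_op (space_grad \<phi> (x, t), space_hess \<phi> (x, t))"
    unfolding grad hess by (intro add_left_mono lsc_envelope_mc_op_ge \<alpha>)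
  also note *
  finally have "H * l * exp (l * t) - N * k * e * (2 * (w \<bullet> b) + q' t) - \<nu> * (\<bar>\<alpha>\<bar> * norm w)
      - \<alpha> * (real CARD('a) - 1) \<le> 0"
    by (simp add: time grad)
  moreover have "\<bar>\<alpha>\<bar> = 2 * \<bar>N * k\<bar> * e" by (simp add: \<alpha>_def e_def abs_mult)
  ultimately show "H * l * exp (l * t)
          + 2 * exp (k * sphere_excess a b q (x, t))
              * (N * k * (- ((x - a - t *\<^sub>R b) \<bullet> b) - q' t / 2 - (real CARD('a) - 1))
                 - \<nu> * \<bar>N * k\<bar> * norm (x - a - t *\<^sub>R b)) \<le> 0"
    unfolding w_def[symmetric] e_def[symmetric] by (simp add: \<alpha>_def algebra_simps)
qed

lemma barrier_uminus: "barrier (- c) (- H) l (- N) k a b q z = - barrier c H l N k a b q z"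
  by (simp add: barrier_def)

text \<open>Barriers are closed under negation, so a barrier touching \<open>- u\<close> from above is the negative of one
  that touches \<open>u\<close> from below. As the curvature operator is odd, only the sign of the driving term
  changes.\<close>

lemma viscosity_supersolution_imp_barrier_subsolution:
  assumes super: "viscosity_supersolution \<nu> \<Psi>m \<Psi>p u0 u" and cont: "continuous_on spacetime u"
  shows "barrier_subsolution (- \<nu>) (\<lambda>x. - \<Psi>p x) (\<lambda>z. - u z)"
  unfolding barrier_subsolution_def
proof (intro allI impI)
  fix c H l N k :: real and a b :: "real^'a" and q q' x t
  assume Nk: "N * k \<noteq> 0" and q: "smooth_on UNIV q" "\<forall>t. (q has_real_derivative q' t) (at t)"
    and t: "t > 0" and max: "\<forall>\<^sub>F z in nhds (x, t).
      - u z - barrier c H l N k a b q z \<le> - u (x, t) - barrier c H l N k a b q (x, t)"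
    and obst: "- \<Psi>p x < - u (x, t)"
  define \<phi> where "\<phi> = barrier (- c) (- H) l (- N) k a b q"
  define us where "us = lsc_envelope spacetime u"
  define w where "w = x - a - t *\<^sub>R b"
  define e where "e = exp (k * sphere_excess a b q (x, t))"
  define \<alpha> where "\<alpha> = 2 * - N * k * e"
  have us: "us z = ereal (u z)" if "z \<in> spacetime" for z
    unfolding us_def using lsc_envelope_eq[OF cont that] .
  have xt: "(x, t) \<in> spacetime" using t by (simp add: spacetime_def)
  have smooth: "smooth_on spacetime_int \<phi>"
    unfolding \<phi>_def by (rule smooth_on_UNIV_subset[OF smooth_on_barrier[OF q(1)]])
  have "\<forall>\<^sub>F z in nhds (x, t). us z - ereal (\<phi> z) \<ge> us (x, t) - ereal (\<phi> (x, t))"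
    using max eventually_spacetime_nhds[OF t, of x]
    by eventually_elim (simp add: us xt \<phi>_def barrier_uminus)
  with super smooth t obst have *:
    "0 \<le> ereal (time_deriv \<phi> (x, t) - \<nu> * norm (space_grad \<phi> (x, t)))
       + usc_envelope mc_dom mc_op (space_grad \<phi> (x, t), space_hess \<phi> (x, t))"
    unfolding viscosity_supersolution_def Let_def us_def[symmetric] by (simp add: us xt)
  have \<alpha>: "\<alpha> \<noteq> 0" using Nk by (simp add: \<alpha>_def e_def)
  have grad: "space_grad \<phi> (x, t) = \<alpha> *\<^sub>R w"
    and hess: "space_hess \<phi> (x, t) = \<alpha> *\<^sub>R mat 1 + (4 * - N * k\<^sup>2 * e) *\<^sub>R tensor w w"
    and time: "time_deriv \<phi> (x, t) = - H * l * exp (l * t) - - N * k * e * (2 * (w \<bullet> b) + q' t)"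
    unfolding \<phi>_def \<alpha>_def w_def e_def
    by (rule barrier_derivatives[OF q(2)[rule_format]])+
  note *
  also have "ereal (time_deriv \<phi> (x, t) - \<nu> * norm (space_grad \<phi> (x, t)))
       + usc_envelope mc_dom mc_op (space_grad \<phi> (x, t), space_hess \<phi> (x, t))
     \<le> ereal (time_deriv \<phi> (x, t) - \<nu> * norm (space_grad \<phi> (x, t))) + ereal (- \<alpha> * (real CARD('a) - 1))"
    unfolding grad hess by (intro add_left_mono usc_envelope_mc_op_le \<alpha>)
  finally have "- H * l * exp (l * t) + N * k * e * (2 * (w \<bullet> b) + q' t) - \<nu> * (\<bar>\<alpha>\<bar> * norm w)
      - \<alpha> * (real CARD('a) - 1) \<ge> 0"
    by (simp add: time grad)
  moreover have "\<bar>\<alpha>\<bar> = 2 * \<bar>N * k\<bar> * e" by (simp add: \<alpha>_def e_def abs_mult)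
  ultimately show "H * l * exp (l * t)
          + 2 * exp (k * sphere_excess a b q (x, t))
              * (N * k * (- ((x - a - t *\<^sub>R b) \<bullet> b) - q' t / 2 - (real CARD('a) - 1))
                 - (- \<nu>) * \<bar>N * k\<bar> * norm (x - a - t *\<^sub>R b)) \<le> 0"
    unfolding w_def[symmetric] e_def[symmetric] by (simp add: \<alpha>_def algebra_simps)
qed

section \<open>Comparison with barriers\<close>

lemma smooth_imp_continuous_derivative:
  assumes "smooth_on UNIV q" "\<And>t. (q has_real_derivative q' t) (at t)"
  shows "continuous_on UNIV q'"
proof -
  have "C_k_on (Suc 0) UNIV q" using assms(1) unfolding smooth_on_def by blast
  then have "continuous_on UNIV (dir_deriv 1 q)" by simp
  also have "dir_deriv 1 q = q'"
    using dir_deriv_eq[OF assms(2)[unfolded has_field_derivative_def], of 1] by (intro ext) simp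
  finally show ?thesis .
qed

lemma continuous_on_barrier:
  assumes "continuous_on UNIV q"
  shows "continuous_on S (sphere_excess a b q)" "continuous_on S (barrier c H l N k a b q)"
proof -
  show 1: "continuous_on S (sphere_excess a b q)" for S
    unfolding sphere_excess_def[abs_def]
    by (intro continuous_intros continuous_on_compose2[OF assms]) auto
  show "continuous_on S (barrier c H l N k a b q)"
    unfolding barrier_def[abs_def] by (intro continuous_intros 1)
qed

text \<open>Here \<open>\<sigma> = 1\<close> stands for the interior and \<open>\<sigma> = -1\<close> for the exterior of the moving sphere, where
  \<open>v \<le> c\<close> is to be shown. The compact set \<open>G\<close> localises the argument; the assumption on contacts says
  that a violation of \<open>v \<le> c\<close> can occur neither on the lateral boundary of \<open>G\<close> nor initially, nor
  where the obstacle switches the equation off. The strictness assumption compares the velocity of the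
  sphere with the one prescribed by the flow, on the sphere only.

  If \<open>v > c\<close> at some point, consider the maximum over \<open>G\<close> of the difference of \<open>v\<close> and a barrier that
  exceeds \<open>v\<close> across the sphere as well as at the final time, but not at that point. At the maximum
  the touching inequality is violated, because of the strictness near the sphere, and because
  of the increasing time dependent term elsewhere.\<close>

lemma barrier_comparison:
  fixes v :: "(real^'n) \<times> real \<Rightarrow> real" and a b x :: "real^'n"
  assumes v: "barrier_subsolution \<nu> \<Psi> v" and cont: "continuous_on spacetime v"
    and \<sigma>: "\<sigma> = 1 \<or> \<sigma> = -1"
    and q: "smooth_on UNIV q" "\<And>t. (q has_real_derivative q' t) (at t)"
    and t0: "0 \<le> t0" and G: "compact G" "G \<subseteq> UNIV \<times> {t0..t1}"
    and contact: "\<And>y t. (y, t) \<in> G \<Longrightarrow> \<sigma> * sphere_excess a b q (y, t) < 0 \<Longrightarrow> c < v (y, t) \<Longrightarrow>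
        t < t1 \<Longrightarrow> t0 < t \<and> (y, t) \<in> interior G \<and> \<Psi> y \<le> c"
    and strict: "\<And>y t. (y, t) \<in> G \<Longrightarrow> sphere_excess a b q (y, t) = 0 \<Longrightarrow>
        0 < \<sigma> * (- ((y - a - t *\<^sub>R b) \<bullet> b) - q' t / 2 - (real CARD('n) - 1)) - \<nu> * norm (y - a - t *\<^sub>R b)"
    and T: "t0 < T" "T \<le> t1" "\<forall>\<^sub>F t in at_left T. (x, t) \<in> G"
    and x: "\<sigma> * sphere_excess a b q (x, T) < 0"
  shows "v (x, T) \<le> c"
proof -
  define s where "s = sphere_excess a b q"
  define br where "br = (\<lambda>(y, t). \<sigma> * (- ((y - a - t *\<^sub>R b) \<bullet> b) - q' t / 2 - (real CARD('n) - 1))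
      - \<nu> * norm (y - a - t *\<^sub>R b))"
  have contq: "continuous_on UNIV q"
    by (intro continuous_at_imp_continuous_on ballI DERIV_isCont[OF q(2)])
  have cs: "continuous_on S s" for S
    unfolding s_def by (rule continuous_on_barrier[OF contq])
  have cbr: "continuous_on S br" for S
    unfolding br_def case_prod_unfold
    by (intro continuous_intros continuous_on_compose2[OF smooth_imp_continuous_derivative[OF q]]) auto
  have cv: "continuous_on G v"
    using cont by (rule continuous_on_subset) (use G(2) t0 in \<open>auto simp: spacetime_def\<close>)
  have before: "v (x, T) \<le> c" if T: "t0 < T" "T < t1" "(x, T) \<in> G" and x: "\<sigma> * s (x, T) < 0" for T
  proof (rule ccontr)
    assume "\<not> v (x, T) \<le> c"
    \<comment> \<open>The excess is split into three: the time dependent term of the barrier at \<open>T\<close>, the spatial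
      term at \<open>(x, T)\<close>, and what remains to make the difference positive there.\<close>
    define \<eta> where "\<eta> = (v (x, T) - c) / 3"
    have "3 * \<eta> = v (x, T) - c" by (simp add: \<eta>_def)
    have \<eta>: "\<eta> > 0" using \<open>\<not> v (x, T) \<le> c\<close> by (simp add: \<eta>_def)
    obtain V where V: "\<And>z. z \<in> G \<Longrightarrow> v z \<le> V"
      using compact_imp_bounded[OF compact_continuous_image[OF cv G(1)]]
      by (auto simp: bounded_iff) (metis abs_le_D1)
    define M where "M = max (V - c) 0 + 1"
    have M: "M > 0" "V < c + M" by (auto simp: M_def)
    \<comment> \<open>The rate \<open>l\<close> is so large that the time dependent term grows from \<open>\<eta>\<close> at time \<open>T\<close> to \<open>M\<close> at
      time \<open>t1\<close>; this excludes a maximum at the final time.\<close>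
    define l where "l = M / \<eta> / (t1 - T)"
    have l: "l > 0" using M \<eta> T by (simp add: l_def)
    have "l * (t1 - T) = M / \<eta>" using T by (simp add: l_def)
    then have "M / \<eta> \<le> exp (l * (t1 - T))"
      using exp_ge_add_one_self[of "l * (t1 - T)"] by linarith
    then have top: "M \<le> \<eta> * exp (l * (t1 - T))"
      using \<eta> by (simp add: field_simps)
    \<comment> \<open>By compactness, strictness on the sphere persists in a layer of thickness \<open>\<delta>\<close>.\<close>
    obtain \<delta> where \<delta>: "\<delta> > 0" "\<And>z. z \<in> G \<Longrightarrow> \<sigma> * s z \<le> 0 \<Longrightarrow> - \<delta> < \<sigma> * s z \<Longrightarrow> 0 < br z"
    proof -
      define G' where "G' = {z \<in> G. \<sigma> * s z \<le> 0 \<and> br z \<le> 0}"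
      have "G' = G \<inter> {z. \<sigma> * s z \<le> 0} \<inter> {z. br z \<le> 0}" by (auto simp: G'_def)
      moreover have "closed {z. \<sigma> * s z \<le> 0}" "closed {z. br z \<le> 0}"
        by (intro closed_Collect_le continuous_intros cs cbr)+
      ultimately have "compact G'" using G(1) by (auto intro: compact_Int_closed)
      show thesis
      proof (cases "G' = {}")
        case True
        then show thesis by (intro that[of 1]) (force simp: G'_def)+
      next
        case False
        have "continuous_on G' (\<lambda>z. \<sigma> * s z)" by (intro continuous_intros cs)
        from continuous_attains_sup[OF \<open>compact G'\<close> False this]
        obtain z where z: "z \<in> G'" "\<And>y. y \<in> G' \<Longrightarrow> \<sigma> * s y \<le> \<sigma> * s z" by blast
        have "s z \<noteq> 0"
          using z(1) strict[of "fst z" "snd z"] by (cases z) (auto simp: G'_def s_def br_def)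
        then have "\<sigma> * s z < 0" using z(1) \<sigma> by (auto simp: G'_def)
        then show thesis
          using z(2) by (intro that[of "- (\<sigma> * s z)"]) (force simp: G'_def)+
      qed
    qed
    obtain C where C: "C \<ge> 0" "\<And>z. z \<in> G \<Longrightarrow> - C \<le> br z"
    proof -
      obtain B where "\<And>z. z \<in> G \<Longrightarrow> \<bar>br z\<bar> \<le> B"
        using compact_imp_bounded[OF compact_continuous_image[OF cbr G(1)]]
        by (auto simp: bounded_iff)
      then show thesis by (intro that[of "max B 0"]) force+
    qed
    \<comment> \<open>A lower bound for the derivative of the time dependent term.\<close>
    define h0 where "h0 = \<eta> * l * exp (l * (t0 - T))"
    have h0: "h0 > 0" using \<eta> l by (simp add: h0_def)
    define \<delta>0 where "\<delta>0 = - (\<sigma> * s (x, T))"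
    have \<delta>0: "\<delta>0 > 0" using x by (simp add: \<delta>0_def)
    have "((\<lambda>k. M * exp (- k * \<delta>0)) \<longlongrightarrow> 0) at_top" using \<delta>0 by real_asymp
    from order_tendstoD(2)[OF this \<eta>]
    have k1: "\<forall>\<^sub>F k in at_top. M * exp (- k * \<delta>0) < \<eta>" .
    have "((\<lambda>k. 2 * (M * k) * exp (- k * \<delta>) * C) \<longlongrightarrow> 0) at_top" using \<delta>(1) by real_asymp
    from order_tendstoD(2)[OF this h0]
    have k2: "\<forall>\<^sub>F k in at_top. 2 * (M * k) * exp (- k * \<delta>) * C < h0" .
    obtain k where k: "M * exp (- k * \<delta>0) < \<eta>" "2 * (M * k) * exp (- k * \<delta>) * C < h0" "k > 0"
      using eventually_happens[OF eventually_conj[OF k1 eventually_conj[OF k2 eventually_gt_at_top[of 0]]]]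
      by auto
    define \<phi> where "\<phi> = barrier c (\<eta> * exp (- l * T)) l M (\<sigma> * k) a b q"
    have \<phi>: "\<phi> z = c + \<eta> * exp (l * (snd z - T)) + M * exp (k * (\<sigma> * s z))" for z
      by (simp add: \<phi>_def barrier_def s_def algebra_simps exp_diff exp_minus field_simps)
    have "continuous_on G (\<lambda>z. v z - \<phi> z)"
      unfolding \<phi>_def by (intro continuous_intros cv continuous_on_barrier[OF contq])
    from continuous_attains_sup[OF G(1) _ this] \<open>(x, T) \<in> G\<close>
    obtain z where z: "z \<in> G" "\<And>y. y \<in> G \<Longrightarrow> v y - \<phi> y \<le> v z - \<phi> z" by blast
    obtain y t where yt: "z = (y, t)" by (cases z)
    have t: "t0 \<le> t" "t \<le> t1" using z(1) G(2) yt by auto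
    have "\<phi> (x, T) < c + \<eta> + \<eta>"
      using k(1) by (simp add: \<phi> \<delta>0_def)
    then have pos: "v (y, t) > \<phi> (y, t)"
      using z(2)[OF \<open>(x, T) \<in> G\<close>] \<eta> \<open>3 * \<eta> = v (x, T) - c\<close> by (simp add: yt)
    have gt_c: "v (y, t) > c"
      using pos \<eta> M by (simp add: \<phi>) (smt (verit) exp_gt_zero mult_pos_pos)
    have lt: "\<sigma> * s (y, t) < 0"
    proof (rule ccontr)
      assume "\<not> \<sigma> * s (y, t) < 0"
      then have "1 \<le> exp (k * (\<sigma> * s (y, t)))" using k(3) by simp
      then have "M \<le> M * exp (k * (\<sigma> * s (y, t)))" using M(1) by simp
      moreover have "0 < \<eta> * exp (l * (t - T))" using \<eta> by simp
      ultimately show False using pos V[of "(y, t)"] z(1) M(2) by (simp add: \<phi> yt)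
    qed
    have "t \<noteq> t1"
    proof
      assume "t = t1"
      moreover have "0 < M * exp (k * (\<sigma> * s (y, t)))" using M by simp
      ultimately show False using pos V[of "(y, t)"] z(1) M(2) top by (simp add: \<phi> yt)
    qed
    with contact[of y t] z(1) lt gt_c t
    have c: "t0 < t" "(y, t) \<in> interior G" "\<Psi> y \<le> c" by (auto simp: s_def yt)
    have "\<forall>\<^sub>F z in nhds (y, t). z \<in> interior G"
      using c(2) by (intro eventually_nhds_in_open) auto
    then have locmax: "\<forall>\<^sub>F z in nhds (y, t). v z - \<phi> z \<le> v (y, t) - \<phi> (y, t)"
      by eventually_elim (use z(2) interior_subset yt in auto)
    define A where "A = - ((y - a - t *\<^sub>R b) \<bullet> b) - q' t / 2 - (real CARD('n) - 1)"
    define r where "r = norm (y - a - t *\<^sub>R b)"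
    have "\<eta> * exp (- l * T) * l * exp (l * t)
          + 2 * exp ((\<sigma> * k) * s (y, t)) * (M * (\<sigma> * k) * A - \<nu> * \<bar>M * (\<sigma> * k)\<bar> * r) \<le> 0"
      unfolding \<phi>_def s_def A_def r_def
      by (intro v[unfolded barrier_subsolution_def, rule_format])
        (use locmax[unfolded \<phi>_def] \<sigma> k M q c t0 gt_c in auto)
    also have "\<bar>M * (\<sigma> * k)\<bar> = M * k" using \<sigma> M k by (auto simp: abs_mult)
    also have "M * (\<sigma> * k) * A - \<nu> * (M * k) * r = M * k * br (y, t)"
      by (simp add: br_def A_def r_def algebra_simps)
    also have "(\<sigma> * k) * s (y, t) = k * (\<sigma> * s (y, t))" by simp
    also have "\<eta> * exp (- l * T) * l * exp (l * t) = \<eta> * l * exp (l * (t - T))"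
    proof -
      have "exp (l * (t - T)) = exp (- l * T) * exp (l * t)"
        by (simp add: algebra_simps flip: exp_add)
      then show ?thesis by simp
    qed
    finally have le: "\<eta> * l * exp (l * (t - T)) + 2 * (M * k) * exp (k * (\<sigma> * s (y, t))) * br (y, t) \<le> 0"
      by (simp add: mult_ac)
    have "h0 \<le> \<eta> * l * exp (l * (t - T))"
      unfolding h0_def using \<eta> l t by (intro mult_left_mono) auto
    moreover have "- h0 < 2 * (M * k) * exp (k * (\<sigma> * s (y, t))) * br (y, t)"
    proof (cases "- \<delta> < \<sigma> * s (y, t)")
      case True
      then have "br (y, t) > 0" using \<delta>(2) z(1) lt yt by auto
      then have "0 < 2 * (M * k) * exp (k * (\<sigma> * s (y, t))) * br (y, t)"
        using M k by simp
      then show ?thesis using h0 by linarith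
    next
      case False
      then have "exp (k * (\<sigma> * s (y, t))) \<le> exp (- k * \<delta>)"
        using k(3) mult_left_mono[of "\<sigma> * s (y, t)" "- \<delta>" k] by simp
      then have "2 * (M * k) * exp (k * (\<sigma> * s (y, t))) * C \<le> 2 * (M * k) * exp (- k * \<delta>) * C"
        using M k C by (intro mult_right_mono mult_left_mono) auto
      moreover have "2 * (M * k) * exp (k * (\<sigma> * s (y, t))) * - C
          \<le> 2 * (M * k) * exp (k * (\<sigma> * s (y, t))) * br (y, t)"
        using M k C(2) z(1) yt by (intro mult_left_mono) auto
      ultimately show ?thesis using k(2) unfolding mult_minus_right by linarith
    qed
    ultimately show False using le by linarith
  qed
  \<comment> \<open>The final time itself follows by continuity.\<close>
  have line: "continuous_on UNIV (\<lambda>t. (x, t))" by (intro continuous_intros)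
  have "((\<lambda>t. \<sigma> * s (x, t)) \<longlongrightarrow> \<sigma> * s (x, T)) (at_left T)"
    using continuous_on_compose2[OF cs[of UNIV] line]
    by (intro tendsto_intros) (auto simp: continuous_on_def intro: tendsto_within_subset)
  from order_tendstoD(2)[OF this, of 0] x
  have ev: "\<forall>\<^sub>F t in at_left T. \<sigma> * s (x, t) < 0" by (simp add: s_def)
  have "\<forall>\<^sub>F t in at_left T. v (x, t) \<le> c"
    using ev T(3) eventually_at_left_real[OF T(1)]
    by eventually_elim (use before T(2) in auto)
  moreover have "((\<lambda>t. v (x, t)) \<longlongrightarrow> v (x, T)) (at_left T)"
  proof -
    have "continuous_on {t0..} (\<lambda>t. v (x, t))"
      by (rule continuous_on_compose2[OF cont]) (use t0 in \<open>auto simp: spacetime_def intro!: continuous_intros\<close>)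
    then have "((\<lambda>t. v (x, t)) \<longlongrightarrow> v (x, T)) (at T within {t0..})"
      using T(1) by (simp add: continuous_on_def)
    then have "((\<lambda>t. v (x, t)) \<longlongrightarrow> v (x, T)) (at T within {t0..T})"
      by (rule tendsto_within_subset) auto
    then show ?thesis
      using at_within_Icc_at_left[OF T(1)] by simp
  qed
  ultimately show ?thesis
    by (intro tendsto_upperbound[of "\<lambda>t. v (x, t)" "v (x, T)" "at_left T"]) auto
qed

section \<open>Geometry of the diamond\<close>

definition taxicab :: "real^2 \<Rightarrow> real" where
  "taxicab x = \<bar>x $ 1\<bar> + \<bar>x $ 2\<bar>"

lemma continuous_on_taxicab: "continuous_on S taxicab"
  unfolding taxicab_def[abs_def] by (intro continuous_intros)

lemma norm_real2: "(norm (x::real^2))\<^sup>2 = (x $ 1)\<^sup>2 + (x $ 2)\<^sup>2"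
  unfolding power2_norm_eq_inner by (simp add: inner_vec_def sum_2 power2_eq_square)

lemma norm_le_taxicab: "norm x \<le> taxicab x"
proof (rule power2_le_imp_le)
  show "(norm x)\<^sup>2 \<le> (taxicab x)\<^sup>2"
    by (simp add: norm_real2 taxicab_def power2_sum)
qed (simp add: taxicab_def)

lemma compact_taxicab_ball: "compact {x. taxicab x \<le> r}"
proof -
  have "closed {x. taxicab x \<le> r}"
    by (intro closed_Collect_le continuous_intros continuous_on_taxicab)
  moreover have "{x. taxicab x \<le> r} \<subseteq> cball 0 r"
    by (auto intro: order_trans[OF norm_le_taxicab])
  ultimately show ?thesis
    by (metis bounded_cball bounded_subset compact_eq_bounded_closed)
qed

text \<open>The vectors \<open>e\<close> for which \<open>axis_frame e f\<close> holds are the directions of the corners of the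
  diamond; the four corners are treated at once by taking coordinates along \<open>e\<close> and \<open>f\<close>.\<close>

definition axis_frame :: "real^2 \<Rightarrow> real^2 \<Rightarrow> bool" where
  "axis_frame e f \<longleftrightarrow> norm e = 1 \<and> e \<bullet> f = 0 \<and>
     (\<forall>y. taxicab y = \<bar>y \<bullet> e\<bar> + \<bar>y \<bullet> f\<bar> \<and> (norm y)\<^sup>2 = (y \<bullet> e)\<^sup>2 + (y \<bullet> f)\<^sup>2)"

lemma axis_frames:
  "axis_frame (axis 1 1) (axis 2 1)" "axis_frame (- axis 1 1) (axis 2 1)"
  "axis_frame (axis 2 1) (axis 1 1)" "axis_frame (- axis 2 1) (axis 1 1)"
  by (simp_all add: axis_frame_def taxicab_def norm_real2 inner_axis inner_axis_axis)
    (simp_all add: axis_def)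

lemma taxicab_triangle: "taxicab (x + y) \<le> taxicab x + taxicab y"
  by (simp add: taxicab_def)

lemma taxicab_scaleR: "taxicab (r *\<^sub>R x) = \<bar>r\<bar> * taxicab x"
  by (simp add: taxicab_def abs_mult algebra_simps)

lemma taxicab_nonneg: "0 \<le> taxicab x"
  by (simp add: taxicab_def)

lemma taxicab_le_norm: "taxicab x \<le> sqrt 2 * norm x"
proof (rule power2_le_imp_le)
  have "0 \<le> (\<bar>x $ 1\<bar> - \<bar>x $ 2\<bar>)\<^sup>2" by simp
  then have "(taxicab x)\<^sup>2 \<le> 2 * ((x $ 1)\<^sup>2 + (x $ 2)\<^sup>2)"
    by (simp add: taxicab_def power2_sum power2_diff)
  then show "(taxicab x)\<^sup>2 \<le> (sqrt 2 * norm x)\<^sup>2"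
    by (simp add: power_mult_distrib norm_real2)
qed simp

text \<open>The point of a closed ball that is farthest out in the taxicab norm lies in a diagonal direction.
  For an open ball the bound is approached, but not attained.\<close>

lemma ball_subset_diamond_iff:
  assumes "0 < r"
  shows "ball z r \<subseteq> {x. taxicab x < R} \<longleftrightarrow> taxicab z + sqrt 2 * r \<le> R"
proof
  assume le: "taxicab z + sqrt 2 * r \<le> R"
  show "ball z r \<subseteq> {x. taxicab x < R}"
  proof clarsimp
    fix x assume "dist z x < r"
    then have "sqrt 2 * norm (x - z) < sqrt 2 * r" by (simp add: dist_norm norm_minus_commute)
    then show "taxicab x < R"
      using taxicab_triangle[of z "x - z", simplified] taxicab_le_norm[of "x - z"] le by linarith
  qed
next
  assume sub: "ball z r \<subseteq> {x. taxicab x < R}"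
  show "taxicab z + sqrt 2 * r \<le> R"
  proof (rule ccontr)
    assume not_le: "\<not> taxicab z + sqrt 2 * r \<le> R"
    define s where "s = max 0 ((R - taxicab z) / sqrt 2)"
    have s: "0 \<le> s" "s < r" "R \<le> taxicab z + sqrt 2 * s"
      using not_le assms by (auto simp: s_def max_def field_simps)
    define sg :: "real \<Rightarrow> real" where "sg a = (if 0 \<le> a then 1 else -1)" for a
    define h where "h = s / sqrt 2"
    have h: "0 \<le> h" "2 * h\<^sup>2 = s\<^sup>2" "2 * h = sqrt 2 * s"
      using s(1) by (simp_all add: h_def power_divide real_div_sqrt field_simps)
    define y :: "real^2" where "y = z + h *\<^sub>R (\<chi> i. sg (z $ i))"
    have "(norm (y - z))\<^sup>2 = s\<^sup>2"
      unfolding norm_real2 by (simp add: y_def sg_def flip: h(2))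
    then have "norm (y - z) = s" using s(1) by simp
    moreover have "taxicab y = taxicab z + sqrt 2 * s"
      unfolding h(3)[symmetric] using h(1) by (auto simp: taxicab_def y_def sg_def)
    ultimately show False
      using sub s by (auto simp: dist_norm norm_minus_commute subset_iff)
  qed
qed

lemma axis_frame_along:
  "\<exists>e f. axis_frame e f \<and> x \<bullet> e = \<bar>x $ i\<bar>"
proof -
  have "i = 1 \<or> i = 2" by (rule exhaust_2)
  then show ?thesis
    using axis_frames by (cases "0 \<le> x $ i") (force simp: inner_axis)+
qed

lemma taxicab_axis_frame: "axis_frame e f \<Longrightarrow> taxicab e = 1"
  unfolding axis_frame_def by (simp add: dot_square_norm)

text \<open>The balls of radius \<open>sqrt 2 * \<kappa>\<close> whose centres lie in the diamond of size \<open>m\<close> cover the diamond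
  of size \<open>m + 2 * \<kappa>\<close> except for four caps at its corners, each cut off by the ball about
  the corresponding corner of the smaller diamond. A suitable centre is found by moving
  both coordinates towards \<open>0\<close> by \<open>\<kappa>\<close>, or to \<open>0\<close> if they are smaller than that.\<close>

lemma beyond_corner_arc_or_near_center:
  fixes x :: "real^2"
  assumes "taxicab x \<le> m + 2 * \<kappa>" "0 \<le> m" "0 < \<kappa>"
  shows "(\<exists>e f. axis_frame e f \<and> m + \<kappa> < x \<bullet> e \<and> sqrt 2 * \<kappa> < norm (x - m *\<^sub>R e)) \<or>
    (\<exists>z. taxicab z \<le> m \<and> norm (x - z) \<le> sqrt 2 * \<kappa>)"
proof (cases "\<bar>x $ 1\<bar> \<le> m + \<kappa> \<and> \<bar>x $ 2\<bar> \<le> m + \<kappa>")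
  case True
  define sh :: "real \<Rightarrow> real" where "sh a = (if \<bar>a\<bar> \<le> \<kappa> then 0 else if 0 \<le> a then a - \<kappa> else a + \<kappa>)" for a
  define z :: "real^2" where "z = (\<chi> i. sh (x $ i))"
  have "taxicab z \<le> m"
    using assms True by (auto simp: taxicab_def z_def sh_def)
  moreover have "\<bar>a - sh a\<bar> \<le> \<kappa>" for a using assms(3) by (auto simp: sh_def)
  then have "(a - sh a)\<^sup>2 \<le> \<kappa>\<^sup>2" for a
    using assms(3) by (metis abs_le_square_iff abs_of_pos)
  from add_mono[OF this[of "x $ 1"] this[of "x $ 2"]]
  have "(norm (x - z))\<^sup>2 \<le> (sqrt 2 * \<kappa>)\<^sup>2"
    unfolding norm_real2 by (simp add: z_def power_mult_distrib)
  then have "norm (x - z) \<le> sqrt 2 * \<kappa>"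
    using assms(3) by (auto intro: power2_le_imp_le)
  ultimately show ?thesis by blast
next
  case False
  then obtain e f where ef: "axis_frame e f" "m + \<kappa> < x \<bullet> e"
    by (metis axis_frame_along not_le)
  show ?thesis
  proof (cases "norm (x - m *\<^sub>R e) \<le> sqrt 2 * \<kappa>")
    case True
    moreover have "taxicab (m *\<^sub>R e) \<le> m"
      using taxicab_axis_frame[OF ef(1)] assms(2) by (simp add: taxicab_scaleR)
    ultimately show ?thesis by blast
  qed (use ef in auto)
qed

section \<open>Regions that are filled\<close>

text \<open>The normal velocity of the moving ball with radius \<open>r = sqrt (q t)\<close> is at most \<open>norm b + r'\<close>, with
  \<open>r' = q' / (2 r)\<close>. The assumption on the speed, divided by \<open>r\<close>, says that this is less than \<open>\<nu>\<close> minus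
  the curvature of the sphere.\<close>

lemma ball_persists:
  fixes u :: "(real^'n) \<times> real \<Rightarrow> real" and a b x :: "real^'n"
  assumes super: "barrier_subsolution (- \<nu>) (\<lambda>y. - \<Psi>p y) (\<lambda>z. - u z)"
    and cont: "continuous_on spacetime u"
    and q: "smooth_on UNIV q" "\<And>t. (q has_real_derivative q' t) (at t)"
    and T: "0 < T"
    and init: "\<And>y. (norm (y - a))\<^sup>2 \<le> q 0 \<Longrightarrow> c \<le> u (y, 0)"
    and obst: "\<And>y t. 0 \<le> t \<Longrightarrow> t \<le> T \<Longrightarrow> (norm (y - a - t *\<^sub>R b))\<^sup>2 \<le> q t \<Longrightarrow> c \<le> \<Psi>p y"
    and speed: "\<And>t. 0 \<le> t \<Longrightarrow> t \<le> T \<Longrightarrow>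
        norm b * sqrt (q t) + q' t / 2 + (real CARD('n) - 1) < \<nu> * sqrt (q t)"
    and x: "(norm (x - a - T *\<^sub>R b))\<^sup>2 < q T"
  shows "c \<le> u (x, T)"
proof -
  define G where "G = {z. snd z \<in> {0..T} \<and> sphere_excess a b q z \<le> 0}"
  have contq: "continuous_on UNIV q"
    by (intro continuous_at_imp_continuous_on ballI DERIV_isCont[OF q(2)])
  have cs: "continuous_on S (sphere_excess a b q)" for S
    by (rule continuous_on_barrier[OF contq])
  have "compact G"
  proof -
    have "G = {z. 0 \<le> snd z} \<inter> {z. snd z \<le> T} \<inter> {z. sphere_excess a b q z \<le> 0}"
      by (auto simp: G_def)
    then have "closed G"
      by (auto intro!: closed_Int closed_Collect_le continuous_intros cs)
    moreover have "bounded G"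
    proof -
      have "bounded (q ` {0..T})"
        by (intro compact_imp_bounded compact_continuous_image continuous_on_subset[OF contq]) auto
      then obtain Q where Q: "\<And>t. t \<in> {0..T} \<Longrightarrow> \<bar>q t\<bar> \<le> Q"
        by (metis bounded_iff imageI real_norm_def)
      have "G \<subseteq> cball 0 (norm a + T * norm b + (1 + Q)) \<times> {0..T}"
      proof (clarsimp simp: G_def)
        fix y t assume t: "0 \<le> t" "t \<le> T" and le: "sphere_excess a b q (y, t) \<le> 0"
        define w where "w = y - a - t *\<^sub>R b"
        have "(norm w)\<^sup>2 \<le> Q"
          using le Q[of t] t by (simp add: sphere_excess_def w_def)
        moreover have "norm w \<le> 1 + (norm w)\<^sup>2"
          using zero_le_power2[of "norm w - 1/2"] by (simp add: power2_eq_square algebra_simps)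
        ultimately have "norm w \<le> 1 + Q" by linarith
        moreover have "norm y \<le> norm a + norm (t *\<^sub>R b) + norm w"
          using norm_triangle_ineq[of "a + t *\<^sub>R b" w] norm_triangle_ineq[of a "t *\<^sub>R b"]
          by (simp add: w_def)
        moreover have "norm (t *\<^sub>R b) \<le> T * norm b"
          using t by (simp add: mult_right_mono)
        ultimately show "norm y \<le> norm a + T * norm b + (1 + Q)" by linarith
      qed
      then show ?thesis
        by (rule bounded_subset[rotated]) (intro bounded_Times bounded_cball bounded_closed_interval)
    qed
    ultimately show ?thesis by (simp add: compact_eq_bounded_closed)
  qed
  have "- u (x, T) \<le> - c"
  proof (rule barrier_comparison[OF super continuous_on_minus[OF cont], of 1 q q' 0 G T])
    show "G \<subseteq> UNIV \<times> {0..T}" by (auto simp: G_def)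
    fix y t assume yt: "(y, t) \<in> G"
    then have t: "0 \<le> t" "t \<le> T" by (auto simp: G_def)
    { assume lt: "1 * sphere_excess a b q (y, t) < 0" and gt: "- c < - u (y, t)" and "t < T"
      have "t \<noteq> 0" using lt gt init[of y] by (auto simp: sphere_excess_def)
      moreover have "(y, t) \<in> interior G"
      proof (rule interiorI)
        show "open ({z. 0 < snd z} \<inter> {z. snd z < T} \<inter> {z. sphere_excess a b q z < 0})"
          by (intro open_Int open_Collect_less continuous_intros cs)
      qed (use lt t \<open>t < T\<close> \<open>t \<noteq> 0\<close> in \<open>auto simp: G_def\<close>)
      moreover have "- \<Psi>p y \<le> - c"
        using obst[OF t, of y] lt by (simp add: sphere_excess_def)
      ultimately show "0 < t \<and> (y, t) \<in> interior G \<and> - \<Psi>p y \<le> - c" using t by auto }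
    assume "sphere_excess a b q (y, t) = 0"
    then have "q t = (norm (y - a - t *\<^sub>R b))\<^sup>2" by (simp add: sphere_excess_def)
    then have w: "sqrt (q t) = norm (y - a - t *\<^sub>R b)" by simp
    have "(y - a - t *\<^sub>R b) \<bullet> b \<le> norm b * norm (y - a - t *\<^sub>R b)"
      using norm_cauchy_schwarz by (metis mult.commute)
    then show "0 < 1 * (- ((y - a - t *\<^sub>R b) \<bullet> b) - q' t / 2 - (real CARD('n) - 1))
        - - \<nu> * norm (y - a - t *\<^sub>R b)"
      using speed[OF t] unfolding w by simp
  next
    have "((\<lambda>t. sphere_excess a b q (x, t)) \<longlongrightarrow> sphere_excess a b q (x, T)) (at_left T)"
    proof -
      have "continuous_on UNIV (\<lambda>t. sphere_excess a b q (x, t))"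
        by (rule continuous_on_compose2[OF cs[of UNIV]]) (auto intro!: continuous_intros)
      then show ?thesis by (auto simp: continuous_on_def intro: tendsto_within_subset)
    qed
    moreover have "sphere_excess a b q (x, T) < 0" using x by (simp add: sphere_excess_def)
    ultimately have "\<forall>\<^sub>F t in at_left T. sphere_excess a b q (x, t) < 0"
      by (auto dest: order_tendstoD)
    with eventually_at_left_real[OF T]
    show "\<forall>\<^sub>F t in at_left T. (x, t) \<in> G"
      by eventually_elim (auto simp: G_def)
  qed (use q T x \<open>compact G\<close> in \<open>auto simp: sphere_excess_def\<close>)
  then show ?thesis by simp
qed

text \<open>The compact sets make this a statement about all levels at once: on \<open>K0\<close> and \<open>K1\<close> positive
  continuous functions are bounded below by some \<open>c > 0\<close>, nonnegative functions by \<open>c = 0\<close>.\<close>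

definition occupied ::
  "((real^2) \<times> real \<Rightarrow> real) \<Rightarrow> (real^2 \<Rightarrow> real) \<Rightarrow> (real^2) set \<Rightarrow> real \<Rightarrow> real^2 \<Rightarrow> real \<Rightarrow> bool" where
  "occupied u \<Psi>p D0 R x T \<longleftrightarrow>
     (\<exists>K0 K1. compact K0 \<and> K0 \<subseteq> D0 \<and> compact K1 \<and> K1 \<subseteq> {y. taxicab y < R} \<and>
       (\<forall>c. (\<forall>y\<in>K0. c \<le> u (y, 0)) \<longrightarrow> (\<forall>y\<in>K1. c \<le> \<Psi>p y) \<longrightarrow> c \<le> u (x, T)))"

text \<open>A ball of radius \<open>1 / \<nu> - w\<close> is unstable, but \<open>w\<close> grows at a rate of about \<open>\<nu>\<^sup>2 w\<close> only. The rate
  \<open>2 \<nu>\<^sup>2 w\<close> is strictly admissible as long as the radius exceeds half the critical one. Hence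
  the initial defect can be chosen so small that \<open>x\<close> is still covered at time \<open>T\<close>.\<close>

lemma critical_ball_persists:
  assumes super: "barrier_subsolution (- \<nu>) (\<lambda>y. - \<Psi>p y) (\<lambda>z. - u z)"
    and cont: "continuous_on spacetime u"
    and \<nu>: "0 < \<nu>" and D0: "ball 0 (inverse \<nu>) \<subseteq> D0" "D0 \<subseteq> {y. taxicab y < R}"
    and x: "x \<in> ball 0 (inverse \<nu>)" and T: "0 < T"
  shows "occupied u \<Psi>p D0 R x T"
proof -
  obtain w1 where w1: "0 < w1" "w1 < inverse \<nu> / 2" "w1 < inverse \<nu> - norm x"
    using field_lbound_gt_zero[of "inverse \<nu> / 2" "inverse \<nu> - norm x"] x \<nu> by auto
  define w0 where "w0 = w1 * exp (- (2 * \<nu>\<^sup>2 * T))"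
  define w where "w t = w0 * exp (2 * \<nu>\<^sup>2 * t)" for t
  define r where "r t = inverse \<nu> - w t" for t
  define q where "q = (\<lambda>t. r t * r t)"
  define q' where "q' = (\<lambda>t. - (4 * \<nu>\<^sup>2 * w t * r t))"
  have w0: "0 < w0" using w1 by (simp add: w0_def)
  have w_mono: "w s \<le> w t" if "s \<le> t" for s t
    using that w0 by (simp add: w_def mult_left_mono)
  have "w T = w1" by (simp add: w_def w0_def flip: exp_add)
  then have wT: "w T < inverse \<nu> / 2" "w T < inverse \<nu> - norm x" using w1 by simp_all
  have w: "0 < w t" "w t < inverse \<nu> / 2" "inverse \<nu> / 2 < r t" if "t \<le> T" for t
    using w_mono[OF that] wT w0 by (auto simp: r_def) (simp add: w_def)
  have smooth: "smooth_on UNIV q"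
  proof -
    have "smooth_on UNIV (\<lambda>t. 2 * \<nu>\<^sup>2 * t + 0 :: real)"
      by (rule smooth_on_affine) (rule bounded_linear_mult_right)
    then have "smooth_on UNIV (\<lambda>t. inverse \<nu> + (- w0) * exp (2 * \<nu>\<^sup>2 * t + 0))"
      by (rule smooth_on_add[OF smooth_on_const smooth_on_mult[OF smooth_on_const smooth_on_exp]])
    also have "(\<lambda>t. inverse \<nu> + (- w0) * exp (2 * \<nu>\<^sup>2 * t + 0)) = r"
      by (simp add: fun_eq_iff r_def w_def)
    finally have r_smooth: "smooth_on UNIV r" .
    show ?thesis unfolding q_def by (rule smooth_on_mult[OF r_smooth r_smooth])
  qed
  have deriv: "(q has_real_derivative q' t) (at t)" for t
    unfolding q_def r_def w_def q'_def by (auto intro!: derivative_eq_intros simp: algebra_simps)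
  have rad: "norm y \<le> r 0" if "t \<in> {0..T}" "(norm y)\<^sup>2 \<le> q t" for y :: "real^2" and t
  proof -
    have "0 < r t" using w(3)[of t] that(1) \<nu> by (simp add: less_trans[of 0 "inverse \<nu> / 2"])
    then have "norm y \<le> r t"
      using that(2) by (intro power2_le_imp_le[of "norm y" "r t"]) (simp_all add: q_def power2_eq_square)
    also have "r t \<le> r 0" using w_mono[of 0 t] that(1) by (simp add: r_def)
    finally show ?thesis .
  qed
  have "cball 0 (r 0) \<subseteq> ball 0 (inverse \<nu>)" using w(1)[of 0] T by (auto simp: r_def)
  then have K: "cball 0 (r 0) \<subseteq> D0" using D0 by blast
  have "c \<le> u (x, T)" if c: "\<forall>y\<in>cball 0 (r 0). c \<le> u (y, 0)" "\<forall>y\<in>cball 0 (r 0). c \<le> \<Psi>p y" for c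
  proof (rule ball_persists[OF super cont smooth deriv T, of 0 c 0])
    show "c \<le> u (y, 0)" if "(norm (y - 0))\<^sup>2 \<le> q 0" for y
      using rad[of 0 y] that c(1) T by simp
    show "c \<le> \<Psi>p y" if "0 \<le> t" "t \<le> T" "(norm (y - 0 - t *\<^sub>R 0))\<^sup>2 \<le> q t" for y t
      using rad[of t y] that c(2) by simp
    have "0 < r T" using w(3)[of T] \<nu> by (simp add: less_trans[of 0 "inverse \<nu> / 2"])
    moreover have "norm x < r T" using wT by (simp add: r_def)
    ultimately have "(norm x)\<^sup>2 < (r T)\<^sup>2" by (intro power_strict_mono) auto
    then show "(norm (x - 0 - T *\<^sub>R 0))\<^sup>2 < q T" by (simp add: q_def power2_eq_square)
    fix t assume t: "0 \<le> t" "t \<le> T"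
    have r: "0 < r t" using w(3)[OF t(2)] \<nu> by (simp add: less_trans[of 0 "inverse \<nu> / 2"])
    have "1 < 2 * \<nu> * r t" using w(3)[OF t(2)] \<nu> by (simp add: field_simps)
    then have "(\<nu> * w t) * 1 < (\<nu> * w t) * (2 * \<nu> * r t)"
      using w(1)[OF t(2)] \<nu> by (intro mult_strict_left_mono) auto
    moreover have "\<nu> * r t = 1 - \<nu> * w t" using \<nu> by (simp add: r_def algebra_simps)
    moreover have "q' t / 2 = - ((\<nu> * w t) * (2 * \<nu> * r t))"
      by (simp add: q'_def power2_eq_square)
    ultimately have "q' t / 2 + 1 < \<nu> * r t" by linarith
    moreover have "sqrt (q t) = r t" using r by (simp add: q_def)
    ultimately show "norm (0::real^2) * sqrt (q t) + q' t / 2 + (real CARD(2) - 1) < \<nu> * sqrt (q t)"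
      by simp
  qed
  then show ?thesis
    unfolding occupied_def using K D0(2) by (intro exI[of _ "cball 0 (r 0)"]) auto
qed

text \<open>Since \<open>\<nu> - 1 / r > 0\<close>, the ball can be moved at any speed below this value, and every target
  can be reached within time \<open>T\<close> if \<open>T\<close> is large. By convexity of the taxicab norm it stays inside
  the diamond on its way.\<close>

lemma supercritical_ball_travels:
  assumes super: "barrier_subsolution (- \<nu>) (\<lambda>y. - \<Psi>p y) (\<lambda>z. - u z)"
    and cont: "continuous_on spacetime u"
    and \<nu>: "0 < \<nu>" and r: "inverse \<nu> < r"
    and K0: "cball a r \<subseteq> D0" and inside: "taxicab a + sqrt 2 * r < R" "taxicab z + sqrt 2 * r < R"
    and x: "x \<in> ball z r"
  shows "\<exists>\<tau>>0. \<forall>T>\<tau>. occupied u \<Psi>p D0 R x T"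
proof -
  have r0: "0 < r" using r \<nu> by (meson inverse_positive_iff_positive less_trans)
  have \<nu>r: "1 < \<nu> * r" using r \<nu> by (simp add: field_simps)
  define R1 where "R1 = max (taxicab a) (taxicab z) + sqrt 2 * r"
  have R1: "R1 < R" using inside by (simp add: R1_def)
  define \<tau> where "\<tau> = norm (z - a) * r / (\<nu> * r - 1) + 1"
  have "0 < \<tau>" using \<nu>r r0 by (simp add: \<tau>_def add_nonneg_pos)
  moreover have "occupied u \<Psi>p D0 R x T" if "\<tau> < T" for T
  proof -
    have T: "0 < T" using that \<open>0 < \<tau>\<close> by simp
    define b where "b = (1 / T) *\<^sub>R (z - a)"
    have speed: "norm b * r + 1 < \<nu> * r"
    proof -
      have "norm (z - a) * r / (\<nu> * r - 1) < T" using that by (simp add: \<tau>_def)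
      then have "norm (z - a) * r < (\<nu> * r - 1) * T"
        using \<nu>r by (simp add: pos_divide_less_eq mult.commute)
      then have "norm (z - a) * r / T < \<nu> * r - 1"
        using T by (simp add: pos_divide_less_eq)
      moreover have "norm b = norm (z - a) / T" using T by (simp add: b_def)
      ultimately show ?thesis by simp
    qed
    have "c \<le> u (x, T)"
      if c: "\<forall>y\<in>cball a r. c \<le> u (y, 0)" "\<forall>y\<in>{y. taxicab y \<le> R1}. c \<le> \<Psi>p y" for c
    proof (rule ball_persists[OF super cont, of "\<lambda>_. r\<^sup>2" "\<lambda>_. 0" T a c b])
      show "smooth_on UNIV (\<lambda>_::real. r\<^sup>2)" by (rule smooth_on_const)
      show "c \<le> u (y, 0)" if "(norm (y - a))\<^sup>2 \<le> r\<^sup>2" for y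
        using that c(1) r0 by (auto simp: dist_norm norm_minus_commute power2_le_iff_abs_le)
      show "c \<le> \<Psi>p y" if t: "0 \<le> t" "t \<le> T" and y: "(norm (y - a - t *\<^sub>R b))\<^sup>2 \<le> r\<^sup>2" for y t
      proof -
        define \<theta> where "\<theta> = t / T"
        have \<theta>: "0 \<le> \<theta>" "\<theta> \<le> 1" using t T by (auto simp: \<theta>_def)
        have "a + t *\<^sub>R b = (1 - \<theta>) *\<^sub>R a + \<theta> *\<^sub>R z"
          by (simp add: b_def \<theta>_def algebra_simps)
        then have "taxicab (a + t *\<^sub>R b) \<le> (1 - \<theta>) * taxicab a + \<theta> * taxicab z"
          using taxicab_triangle[of "(1 - \<theta>) *\<^sub>R a" "\<theta> *\<^sub>R z"] \<theta> by (simp add: taxicab_scaleR)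
        also have "\<dots> \<le> max (taxicab a) (taxicab z)"
          using \<theta> by (intro convex_bound_le) auto
        finally have "taxicab (a + t *\<^sub>R b) \<le> max (taxicab a) (taxicab z)" .
        moreover have "taxicab y \<le> taxicab (a + t *\<^sub>R b) + taxicab (y - a - t *\<^sub>R b)"
          using taxicab_triangle[of "a + t *\<^sub>R b" "y - a - t *\<^sub>R b"] by simp
        moreover have "norm (y - a - t *\<^sub>R b) \<le> r" using y r0 by (simp add: power2_le_iff_abs_le)
        then have "sqrt 2 * norm (y - a - t *\<^sub>R b) \<le> sqrt 2 * r" by simp
        then have "taxicab (y - a - t *\<^sub>R b) \<le> sqrt 2 * r"
          using taxicab_le_norm order_trans by blast
        ultimately show ?thesis using c(2) by (simp add: R1_def)
      qed
      show "norm b * sqrt (r\<^sup>2) + 0 / 2 + (real CARD(2) - 1) < \<nu> * sqrt (r\<^sup>2)"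
        using speed r0 by simp
      have arrival: "x - a - T *\<^sub>R b = x - z" using T by (simp add: b_def)
      have "norm (x - z) < r" using x by (simp add: dist_norm norm_minus_commute)
      then show "(norm (x - a - T *\<^sub>R b))\<^sup>2 < r\<^sup>2"
        unfolding arrival by (intro power_strict_mono) auto
    qed (use T in auto)
    then show ?thesis
      unfolding occupied_def using K0 R1 compact_taxicab_ball[of R1]
      by (intro exI[of _ "cball a r"] exI[of _ "{y. taxicab y \<le> R1}"]) auto
  qed
  ultimately show ?thesis by blast
qed

text \<open>For \<open>R > sqrt 2 / \<nu>\<close> the critical ball about \<open>z\<close> may touch the sides of the diamond. Scaling
  its centre towards the origin by a factor \<open>1 - \<epsilon>\<close> makes room to enlarge the radius by some \<open>\<mu> > 0\<close>,
  while the point \<open>x\<close> of the open ball is retained for small \<open>\<epsilon>\<close>.\<close>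

lemma union_of_critical_balls_filled:
  assumes super: "barrier_subsolution (- \<nu>) (\<lambda>y. - \<Psi>p y) (\<lambda>z. - u z)"
    and cont: "continuous_on spacetime u"
    and \<nu>: "0 < \<nu>" and D0: "D0 \<subseteq> {y. taxicab y < R}"
    and cases: "(R = sqrt 2 * inverse \<nu> \<and> ball 0 (inverse \<nu>) \<subseteq> D0) \<or>
       (R < sqrt 2 * inverse \<nu>) \<or>
       (R > sqrt 2 * inverse \<nu> \<and> (\<exists>zhat. \<exists>\<delta>>0. ball zhat (inverse \<nu> + \<delta>) \<subseteq> D0))"
    and z: "ball z (inverse \<nu>) \<subseteq> {y. taxicab y < R}" and x: "x \<in> ball z (inverse \<nu>)"
  shows "\<exists>\<tau>>0. \<forall>T>\<tau>. occupied u \<Psi>p D0 R x T"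
proof -
  define i where "i = inverse \<nu>"
  have i: "0 < i" using \<nu> by (simp add: i_def)
  have z': "taxicab z + sqrt 2 * i \<le> R"
    using z ball_subset_diamond_iff[of i z R] i by (simp add: i_def)
  show ?thesis
  proof (cases "R = sqrt 2 * i")
    case True
    have "norm z \<le> 0" using z' True norm_le_taxicab[of z] by linarith
    then have "z = 0" by simp
    then show ?thesis
      using critical_ball_persists[OF super cont \<nu> _ D0, of x] cases x True
      by (intro exI[of _ 1]) (auto simp: i_def)
  next
    case False
    then have "sqrt 2 * i < R" using z' taxicab_nonneg[of z] by linarith
    then obtain a \<delta> where a: "0 < \<delta>" "ball a (i + \<delta>) \<subseteq> D0"
      using cases by (auto simp: i_def)
    then have a': "taxicab a + sqrt 2 * (i + \<delta>) \<le> R"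
      using D0 ball_subset_diamond_iff[of "i + \<delta>" a R] i by auto
    have xz: "norm (x - z) < i" using x by (simp add: i_def dist_norm norm_minus_commute)
    have nz: "0 < norm z + 1" by (simp add: add_nonneg_pos)
    have "0 < (i - norm (x - z)) / (norm z + 1)" using xz nz by simp
    from field_lbound_gt_zero[OF zero_less_one this] obtain \<epsilon> where \<epsilon>: "0 < \<epsilon>" "\<epsilon> < 1"
      and "\<epsilon> < (i - norm (x - z)) / (norm z + 1)" by blast
    then have "\<epsilon> * (norm z + 1) < i - norm (x - z)"
      using nz by (simp add: pos_less_divide_eq)
    then have \<epsilon>z: "norm (x - z) + \<epsilon> * norm z < i"
      using \<epsilon>(1) by (simp add: algebra_simps)
    define gap where "gap = \<epsilon> * (R - sqrt 2 * i)"
    have gap: "0 < gap" using \<epsilon> \<open>sqrt 2 * i < R\<close> by (simp add: gap_def)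
    have "0 < gap / sqrt 2" using gap by simp
    from field_lbound_gt_zero[OF a(1) this] obtain \<mu> where \<mu>: "0 < \<mu>" "\<mu> < \<delta>" "\<mu> < gap / sqrt 2"
      by blast
    then have \<mu>_gap: "sqrt 2 * \<mu> < gap" by (simp add: field_simps)
    show ?thesis
    proof (rule supercritical_ball_travels[OF super cont \<nu>, of "i + \<mu>" a D0 R "(1 - \<epsilon>) *\<^sub>R z" x])
      show "inverse \<nu> < i + \<mu>" using \<mu> by (simp add: i_def)
      show "cball a (i + \<mu>) \<subseteq> D0" using a(2) \<mu>(2) by (auto simp: subset_iff)
      have "sqrt 2 * \<mu> < sqrt 2 * \<delta>" using \<mu>(2) by simp
      then show "taxicab a + sqrt 2 * (i + \<mu>) < R" using a' unfolding distrib_left by linarith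
      have "(1 - \<epsilon>) * taxicab z \<le> (1 - \<epsilon>) * (R - sqrt 2 * i)"
        using z' \<epsilon> by (intro mult_left_mono) auto
      then show "taxicab ((1 - \<epsilon>) *\<^sub>R z) + sqrt 2 * (i + \<mu>) < R"
        using \<mu>_gap \<epsilon> unfolding taxicab_scaleR gap_def by (simp add: algebra_simps)
      have "norm (x - (1 - \<epsilon>) *\<^sub>R z) \<le> norm (x - z) + norm (\<epsilon> *\<^sub>R z)"
        using norm_triangle_ineq[of "x - z" "\<epsilon> *\<^sub>R z"] by (simp add: algebra_simps)
      then show "x \<in> ball ((1 - \<epsilon>) *\<^sub>R z) (i + \<mu>)"
        using \<epsilon>z \<epsilon> \<mu> by (simp add: dist_norm norm_minus_commute)
    qed
  qed
qed

section \<open>Regions that are evacuated\<close>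

text \<open>The ball of radius \<open>\<rho>\<close> about \<open>p t *\<^sub>R e\<close>, where \<open>p\<close> moves with constant speed from \<open>R - \<rho>\<close> to
  \<open>p1\<close>, confines the part of \<open>{u > c}\<close> in the half plane \<open>(p t + R) / 2 \<le> y \<bullet> e\<close>. The line
  bounding this half plane joins the midpoints of the two chords that the circle cuts out
  of the sides of the diamond; therefore it stays in the interior of the ball as long as the distance
  \<open>(R - p t) / sqrt 2\<close> of its centre from these sides is less than \<open>\<rho>\<close>, and beyond this line the
  exterior of the ball is separated from the rest of the diamond. Initially the circle passes through
  the corner, and the closed ball contains the whole part of the diamond in the half plane.\<close>

lemma corner_confinement:
  fixes u :: "(real^2) \<times> real \<Rightarrow> real" and e x :: "real^2"
  assumes sub: "barrier_subsolution \<nu> \<Psi>m u" and cont: "continuous_on spacetime u"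
    and frame: "axis_frame e f" and T: "0 < T" and \<nu>: "0 < \<nu>"
    and outside: "\<And>y t. 0 \<le> t \<Longrightarrow> t \<le> T \<Longrightarrow> R \<le> taxicab y \<Longrightarrow> u (y, t) \<le> c"
    and obst: "\<And>y. taxicab y \<le> R \<Longrightarrow> \<Psi>m y \<le> c"
    and \<rho>: "0 < \<rho>" and p1: "p1 \<le> R" "R - p1 < sqrt 2 * \<rho>"
    and speed: "\<rho> * (\<nu> + \<bar>p1 - R + \<rho>\<bar> / T) < 1"
    and x: "(p1 + R) / 2 < x \<bullet> e" "\<rho> < norm (x - p1 *\<^sub>R e)"
  shows "u (x, T) \<le> c"
proof (cases "taxicab x < R")
  case False
  then show ?thesis using outside[of T x] T by simp
next
  case True
  define m where "m = (p1 - R + \<rho>) / T"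
  define p where "p t = R - \<rho> + t * m" for t
  have pT: "p T = p1" using T by (simp add: p_def m_def)
  have p0: "p 0 = R - \<rho>" by (simp add: p_def)
  have width: "0 \<le> R - p t \<and> (R - p t)\<^sup>2 / 2 < \<rho>\<^sup>2" if t: "0 \<le> t" "t \<le> T" for t
  proof -
    define \<theta> where "\<theta> = t / T"
    have \<theta>: "0 \<le> \<theta>" "\<theta> \<le> 1" using t T by (auto simp: \<theta>_def)
    have R: "R - p t = (1 - \<theta>) * \<rho> + \<theta> * (R - p1)"
      using T by (simp add: p_def m_def \<theta>_def field_simps)
    have "0 \<le> (1 - \<theta>) * \<rho> + \<theta> * (R - p1)"
      using \<theta> \<rho> p1 by (intro add_nonneg_nonneg mult_nonneg_nonneg) auto
    moreover have "(1 - \<theta>) * \<rho> + \<theta> * (R - p1) < sqrt 2 * \<rho>"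
    proof (rule convex_bound_lt)
      show "\<rho> < sqrt 2 * \<rho>" using \<rho> by simp
    qed (use \<theta> p1 in auto)
    ultimately have "0 \<le> R - p t" "R - p t < sqrt 2 * \<rho>" by (simp_all add: R)
    then have "(R - p t)\<^sup>2 < (sqrt 2 * \<rho>)\<^sup>2" by (intro power_strict_mono) auto
    then show ?thesis using \<open>0 \<le> R - p t\<close> by (simp add: power_mult_distrib)
  qed
  define a where "a = (R - \<rho>) *\<^sub>R e"
  define b where "b = m *\<^sub>R e"
  have center: "y - a - t *\<^sub>R b = y - p t *\<^sub>R e" for y t
    by (simp add: a_def b_def p_def algebra_simps)
  have ee: "e \<bullet> e = 1" "e \<bullet> f = 0" "norm e = 1"
    using frame by (auto simp: axis_frame_def dot_square_norm)
  have dist: "(norm (y - r *\<^sub>R e))\<^sup>2 = (y \<bullet> e - r)\<^sup>2 + (y \<bullet> f)\<^sup>2" for y r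
    using frame unfolding axis_frame_def by (simp add: inner_diff_left ee)
  have taxi: "taxicab y = \<bar>y \<bullet> e\<bar> + \<bar>y \<bullet> f\<bar>" for y
    using frame unfolding axis_frame_def by simp
  define q where "q = (\<lambda>t::real. \<rho>\<^sup>2)"
  define G where "G = {z::(real^2) \<times> real. snd z \<in> {0..T} \<and> taxicab (fst z) \<le> R \<and> (p (snd z) + R) / 2 \<le> fst z \<bullet> e}"
  have ct: "continuous_on S (\<lambda>z::(real^2) \<times> real. taxicab (fst z))" for S
    by (rule continuous_on_compose2[OF continuous_on_taxicab[of UNIV]]) (auto intro: continuous_intros)
  have "G \<subseteq> {y. taxicab y \<le> R} \<times> {0..T}" by (auto simp: G_def)
  moreover have "closed G"
  proof -
    have "G = {z. 0 \<le> snd z} \<inter> {z. snd z \<le> T} \<inter> {z. taxicab (fst z) \<le> R}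
        \<inter> {z. (p (snd z) + R) / 2 \<le> fst z \<bullet> e}"
      by (auto simp: G_def)
    moreover have "closed \<dots>"
      unfolding p_def by (intro closed_Int closed_Collect_le continuous_intros ct) auto
    ultimately show ?thesis by simp
  qed
  ultimately have "compact G"
    by (metis compact_Times compact_taxicab_ball compact_Icc compact_Int_closed inf.absorb_iff2)
  show ?thesis
  proof (rule barrier_comparison[OF sub cont, of "-1" q "\<lambda>_. 0" 0 G T a b])
    show "smooth_on UNIV q" unfolding q_def by (rule smooth_on_const)
    show "(q has_real_derivative 0) (at t)" for t unfolding q_def by (rule DERIV_const)
    show "G \<subseteq> UNIV \<times> {0..T}" by (auto simp: G_def)
    fix y t assume yt: "(y, t) \<in> G"
    then have t: "0 \<le> t" "t \<le> T" and y: "taxicab y \<le> R" "(p t + R) / 2 \<le> y \<bullet> e" by (auto simp: G_def)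
    { assume lt: "- 1 * sphere_excess a b q (y, t) < 0" and gt: "c < u (y, t)" and "t < T"
      have far: "\<rho>\<^sup>2 < (norm (y - p t *\<^sub>R e))\<^sup>2"
        using lt by (simp add: sphere_excess_def center q_def)
      have "taxicab y < R" using outside[OF t, of y] gt y by force
      have "t \<noteq> 0"
      proof
        assume "t = 0"
        define A where "A = y \<bullet> e - p 0"
        have "0 \<le> A" "A \<le> \<rho>" "\<bar>y \<bullet> f\<bar> \<le> \<rho> - A"
          using y \<rho> unfolding A_def taxi \<open>t = 0\<close> p0 by (auto simp: abs_if split: if_splits)
        then have "A\<^sup>2 + (y \<bullet> f)\<^sup>2 \<le> A\<^sup>2 + (\<rho> - A)\<^sup>2" by (auto intro: abs_le_square_iff[THEN iffD1])
        also have "\<dots> = \<rho>\<^sup>2 - 2 * (A * (\<rho> - A))" by (simp add: power2_eq_square algebra_simps)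
        also have "\<dots> \<le> \<rho>\<^sup>2" using \<open>0 \<le> A\<close> \<open>A \<le> \<rho>\<close> by simp
        finally show False using far by (simp add: dist A_def \<open>t = 0\<close>)
      qed
      moreover have "(p t + R) / 2 \<noteq> y \<bullet> e"
      proof
        assume eq: "(p t + R) / 2 = y \<bullet> e"
        have "\<bar>y \<bullet> f\<bar> \<le> (R - p t) / 2"
          using y(1) unfolding taxi using eq by (auto simp: abs_if field_simps split: if_splits)
        then have "(y \<bullet> f)\<^sup>2 \<le> ((R - p t) / 2)\<^sup>2"
          using width[OF t] by (intro abs_le_square_iff[THEN iffD1]) auto
        moreover have half: "y \<bullet> e - p t = (R - p t) / 2" using eq by (simp add: field_simps)
        ultimately have "(norm (y - p t *\<^sub>R e))\<^sup>2 \<le> (R - p t)\<^sup>2 / 2"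
          unfolding dist half by (simp add: power_divide)
        then show False using far width[OF t] by linarith
      qed
      moreover have "(y, t) \<in> interior G" if "t \<noteq> 0" "(p t + R) / 2 \<noteq> y \<bullet> e"
      proof (rule interiorI)
        show "open ({z. 0 < snd z} \<inter> {z. snd z < T} \<inter> {z. taxicab (fst z) < R}
            \<inter> {z. (p (snd z) + R) / 2 < fst z \<bullet> e})"
          unfolding p_def by (intro open_Int open_Collect_less continuous_intros ct) auto
      qed (use that y t \<open>t < T\<close> \<open>taxicab y < R\<close> in \<open>auto simp: G_def\<close>)
      ultimately show "0 < t \<and> (y, t) \<in> interior G \<and> \<Psi>m y \<le> c" using t obst[OF y(1)] by auto }
    assume "sphere_excess a b q (y, t) = 0"
    then have w: "norm (y - a - t *\<^sub>R b) = \<rho>" using \<rho> by (simp add: sphere_excess_def q_def)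
    have "- ((y - a - t *\<^sub>R b) \<bullet> b) \<le> norm (y - a - t *\<^sub>R b) * norm b"
      using Cauchy_Schwarz_ineq2[of "y - a - t *\<^sub>R b" b] by linarith
    also have "\<dots> = \<rho> * (\<bar>p1 - R + \<rho>\<bar> / T)"
      unfolding w using T by (simp add: b_def m_def ee)
    finally show "0 < -1 * (- ((y - a - t *\<^sub>R b) \<bullet> b) - 0 / 2 - (real CARD(2) - 1))
        - \<nu> * norm (y - a - t *\<^sub>R b)"
      using speed unfolding w by (simp add: algebra_simps)
  next
    have "((\<lambda>t. (p t + R) / 2) \<longlongrightarrow> (p T + R) / 2) (at_left T)"
      unfolding p_def by (intro tendsto_intros) auto
    then have "\<forall>\<^sub>F t in at_left T. (p t + R) / 2 < x \<bullet> e"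
      using x(1) pT by (auto dest: order_tendstoD)
    with eventually_at_left_real[OF T]
    show "\<forall>\<^sub>F t in at_left T. (x, t) \<in> G"
      by eventually_elim (use True in \<open>auto simp: G_def\<close>)
    have "\<rho>\<^sup>2 < (norm (x - p1 *\<^sub>R e))\<^sup>2" using x(2) \<rho> by (intro power_strict_mono) auto
    then show "- 1 * sphere_excess a b q (x, T) < 0"
      by (simp add: sphere_excess_def center pT q_def)
  qed (use T \<open>compact G\<close> in auto)
qed

text \<open>A ball of radius at most \<open>\<rho> < 1 / \<nu>\<close> shrinks so fast that its squared radius \<open>q\<close> decreases at a
  rate of at least \<open>2 (1 - \<nu> \<rho>)\<close>. Half of this rate leaves the margin that the
  strict comparison needs.\<close>

lemma small_ball_vanishes:
  fixes u :: "(real^2) \<times> real \<Rightarrow> real" and x :: "real^2"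
  assumes sub: "barrier_subsolution \<nu> \<Psi>m u" and cont: "continuous_on spacetime u"
    and \<nu>: "0 < \<nu>" and t0: "0 \<le> t0"
    and outside: "\<And>y t. t0 \<le> t \<Longrightarrow> t \<le> T \<Longrightarrow> R \<le> taxicab y \<Longrightarrow> u (y, t) \<le> c"
    and obst: "\<And>y. taxicab y \<le> R \<Longrightarrow> \<Psi>m y \<le> c"
    and init: "\<And>y. \<rho> < norm y \<Longrightarrow> u (y, t0) \<le> c"
    and \<rho>: "0 < \<rho>" "\<nu> * \<rho> < 1" and T: "\<rho>\<^sup>2 < (1 - \<nu> * \<rho>) * (T - t0)"
  shows "u (x, T) \<le> c"
proof -
  have "0 < (1 - \<nu> * \<rho>) * (T - t0)" using T zero_le_power2[of \<rho>] by linarith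
  then have "t0 < T" using \<rho>(2) by (simp add: zero_less_mult_iff)
  show ?thesis
  proof (cases "taxicab x < R")
    case False
    then show ?thesis using outside[of T x] \<open>t0 < T\<close> by simp
  next
    case True
    define q where "q = (\<lambda>t. \<rho>\<^sup>2 - (1 - \<nu> * \<rho>) * (t - t0))"
    define G where "G = {y. taxicab y \<le> R} \<times> {t0..T}"
    have q_smooth: "smooth_on UNIV q"
    proof -
      have "smooth_on UNIV (\<lambda>t. - (1 - \<nu> * \<rho>) * t + (\<rho>\<^sup>2 + (1 - \<nu> * \<rho>) * t0))"
        by (rule smooth_on_affine) (rule bounded_linear_mult_right)
      then show ?thesis by (simp add: q_def algebra_simps)
    qed
    have q_le: "q t \<le> \<rho>\<^sup>2" if "t0 \<le> t" for t
      using that \<rho>(2) by (simp add: q_def)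
    show ?thesis
    proof (rule barrier_comparison[OF sub cont, of "-1" q "\<lambda>_. - (1 - \<nu> * \<rho>)" t0 G T 0 0])
      show "smooth_on UNIV q" by (rule q_smooth)
      show "(q has_real_derivative - (1 - \<nu> * \<rho>)) (at t)" for t
        unfolding q_def by (auto intro!: derivative_eq_intros)
      show "compact G" unfolding G_def by (intro compact_Times compact_taxicab_ball compact_Icc)
      show "G \<subseteq> UNIV \<times> {t0..T}" by (auto simp: G_def)
      fix y t assume yt: "(y, t) \<in> G"
      then have t: "t0 \<le> t" "t \<le> T" and y: "taxicab y \<le> R" by (auto simp: G_def)
      { assume lt: "- 1 * sphere_excess 0 0 q (y, t) < 0" and gt: "c < u (y, t)" and "t < T"
        have "taxicab y < R" using outside[OF t, of y] gt y by force
        have "t \<noteq> t0"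
        proof
          assume "t = t0"
          then have "\<rho>\<^sup>2 < (norm y)\<^sup>2" using lt by (simp add: sphere_excess_def q_def)
          then have "\<rho> < norm y" by (rule power2_less_imp_less) simp
          then show False using init[of y] gt \<open>t = t0\<close> by simp
        qed
        moreover have "(y, t) \<in> interior G"
        proof (rule interiorI)
          show "open ({y. taxicab y < R} \<times> {t0<..<T})"
            by (intro open_Times open_Collect_less continuous_on_taxicab continuous_intros)
        qed (use y t \<open>t < T\<close> \<open>t \<noteq> t0\<close> \<open>taxicab y < R\<close> in \<open>auto simp: G_def\<close>)
        ultimately show "t0 < t \<and> (y, t) \<in> interior G \<and> \<Psi>m y \<le> c" using t obst[OF y] by auto }
      assume "sphere_excess 0 0 q (y, t) = 0"
      then have "(norm y)\<^sup>2 \<le> \<rho>\<^sup>2" using q_le[OF t(1)] by (simp add: sphere_excess_def)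
      then have "norm y \<le> \<rho>" using \<rho> by (simp add: power2_le_iff_abs_le)
      then have "\<nu> * norm y \<le> \<nu> * \<rho>" using \<nu> by simp
      then show "0 < -1 * (- ((y - 0 - t *\<^sub>R 0) \<bullet> 0) - - (1 - \<nu> * \<rho>) / 2 - (real CARD(2) - 1))
          - \<nu> * norm (y - 0 - t *\<^sub>R 0)"
        using \<rho> by (simp add: field_simps)
    next
      show "\<forall>\<^sub>F t in at_left T. (x, t) \<in> G"
        using eventually_at_left_real[OF \<open>t0 < T\<close>]
        by eventually_elim (use True in \<open>auto simp: G_def\<close>)
      have "q T < (norm x)\<^sup>2" unfolding q_def using T zero_le_power2[of "norm x"] by linarith
      then show "- 1 * sphere_excess 0 0 q (x, T) < 0" by (simp add: sphere_excess_def)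
    qed (use \<open>t0 < T\<close> t0 in auto)
  qed
qed

text \<open>For these levels \<open>c\<close>, the upper obstacle keeps \<open>{u > c}\<close> inside the diamond of size \<open>R\<close>, where the
  lower obstacle is not felt above the level \<open>c\<close>.\<close>

definition confined ::
  "((real^2) \<times> real \<Rightarrow> real) \<Rightarrow> (real^2 \<Rightarrow> real) \<Rightarrow> real \<Rightarrow> real \<Rightarrow> real \<Rightarrow> bool" where
  "confined u \<Psi>m R T c \<longleftrightarrow>
     (\<forall>y t. 0 \<le> t \<longrightarrow> t \<le> T \<longrightarrow> R \<le> taxicab y \<longrightarrow> u (y, t) \<le> c) \<and> (\<forall>y. taxicab y \<le> R \<longrightarrow> \<Psi>m y \<le> c)"

text \<open>The arc of radius \<open>1 / \<nu>\<close> that touches the sides of the diamond cannot be reached, since neither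
  the confining ball may be critical nor the distance of its centre from the sides equal to its radius. As \<open>x\<close> lies
  strictly beyond this arc, there is room to decrease the radius and to shift the centre by
  multiples of a small \<open>\<delta>\<close>, and also to enlarge the diamond, which is what makes room for a negative
  level \<open>c\<close> in the closed evolution.\<close>

lemma evacuated_beyond_corner_arc:
  assumes sub: "barrier_subsolution \<nu> \<Psi>m u" and cont: "continuous_on spacetime u"
    and \<nu>: "0 < \<nu>" and R: "sqrt 2 * inverse \<nu> \<le> R"
    and x: "taxicab x \<le> R" "\<And>z. taxicab z + sqrt 2 * inverse \<nu> \<le> R \<Longrightarrow> x \<notin> cball z (inverse \<nu>)"
  shows "\<exists>R'>R. \<exists>\<tau>>0. \<forall>T>\<tau>. \<forall>c. confined u \<Psi>m R' T c \<longrightarrow> u (x, T) \<le> c"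
proof -
  define \<kappa> where "\<kappa> = inverse \<nu> / sqrt 2"
  define m where "m = R - 2 * \<kappa>"
  have \<kappa>: "0 < \<kappa>" "sqrt 2 * \<kappa> = inverse \<nu>" using \<nu> by (simp_all add: \<kappa>_def)
  have two\<kappa>: "2 * \<kappa> = sqrt 2 * inverse \<nu>"
    by (simp add: \<kappa>(2)[symmetric])
  have m: "taxicab x \<le> m + 2 * \<kappa>" "0 \<le> m" using x(1) R two\<kappa> by (simp_all add: m_def)
  have "inverse \<nu> < norm (x - z)" if "taxicab z \<le> m" for z
    using x(2)[of z] that two\<kappa> by (simp add: m_def dist_norm norm_minus_commute)
  then obtain e f where ef: "axis_frame e f" "m + \<kappa> < x \<bullet> e" "inverse \<nu> < norm (x - m *\<^sub>R e)"
    using beyond_corner_arc_or_near_center[OF m \<kappa>(1)] unfolding \<kappa>(2) by (meson not_le)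
  define \<delta> where "\<delta> = Min {\<kappa> / 2, (x \<bullet> e - (m + \<kappa>)) / 3, (norm (x - m *\<^sub>R e) - inverse \<nu>) / 4}"
  have "0 < \<delta>" using ef \<kappa> by (simp add: \<delta>_def)
  moreover have "\<delta> \<le> d" if "d \<in> {\<kappa> / 2, (x \<bullet> e - (m + \<kappa>)) / 3, (norm (x - m *\<^sub>R e) - inverse \<nu>) / 4}" for d
    unfolding \<delta>_def using that by (intro Min_le) auto
  ultimately have \<delta>: "0 < \<delta>" "\<delta> \<le> \<kappa> / 2" "\<delta> \<le> (x \<bullet> e - (m + \<kappa>)) / 3"
    "\<delta> \<le> (norm (x - m *\<^sub>R e) - inverse \<nu>) / 4"
    by blast+
  define \<rho> where "\<rho> = sqrt 2 * (\<kappa> - \<delta>)"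
  define R' where "R' = R + \<delta>"
  define p1 where "p1 = m + 4 * \<delta>"
  have \<rho>: "0 < \<rho>" using \<delta> \<kappa> by (simp add: \<rho>_def)
  have \<nu>\<rho>: "\<nu> * \<rho> < 1"
  proof -
    have "\<rho> < inverse \<nu>" using \<delta>(1) by (simp add: \<rho>_def flip: \<kappa>(2))
    then show ?thesis using \<nu> by (simp add: field_simps)
  qed
  have sqrt2\<rho>: "sqrt 2 * \<rho> = 2 * (\<kappa> - \<delta>)" by (simp add: \<rho>_def flip: mult.assoc)
  have ne: "norm e = 1" using ef(1) by (simp add: axis_frame_def)
  \<comment> \<open>From this time on the required speed of the arc is admissible.\<close>
  define \<tau> where "\<tau> = \<rho> * \<bar>p1 - R' + \<rho>\<bar> / (1 - \<nu> * \<rho>) + 1"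
  have "0 < \<tau>" using \<rho> \<nu>\<rho> by (simp add: \<tau>_def add_nonneg_pos)
  moreover have "u (x, T) \<le> c" if T: "\<tau> < T" and c: "confined u \<Psi>m R' T c" for T c
  proof (rule corner_confinement[OF sub cont ef(1), of T R' c \<rho> p1])
    show "0 < T" using T \<open>0 < \<tau>\<close> by simp
    have "\<rho> * \<bar>p1 - R' + \<rho>\<bar> / (1 - \<nu> * \<rho>) < T" using T by (simp add: \<tau>_def)
    then have "\<rho> * \<bar>p1 - R' + \<rho>\<bar> < (1 - \<nu> * \<rho>) * T"
      using \<nu>\<rho> by (simp add: pos_divide_less_eq mult.commute)
    then have "\<rho> * \<bar>p1 - R' + \<rho>\<bar> / T < 1 - \<nu> * \<rho>"
      using \<open>0 < T\<close> by (simp add: pos_divide_less_eq)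
    then show "\<rho> * (\<nu> + \<bar>p1 - R' + \<rho>\<bar> / T) < 1"
      by (simp add: algebra_simps)
    show "p1 \<le> R'" "R' - p1 < sqrt 2 * \<rho>" "(p1 + R') / 2 < x \<bullet> e"
      unfolding sqrt2\<rho> using \<delta> by (simp_all add: p1_def R'_def m_def field_simps)
    have "norm (x - m *\<^sub>R e) \<le> norm (x - p1 *\<^sub>R e) + norm ((4 * \<delta>) *\<^sub>R e)"
      using norm_triangle_ineq[of "x - p1 *\<^sub>R e" "(4 * \<delta>) *\<^sub>R e"]
      by (simp add: p1_def algebra_simps)
    moreover have "\<rho> < inverse \<nu>" using \<delta>(1) by (simp add: \<rho>_def flip: \<kappa>(2))
    ultimately show "\<rho> < norm (x - p1 *\<^sub>R e)" using \<delta> ne by simp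
  qed (use c \<nu> \<rho> in \<open>auto simp: confined_def\<close>)
  ultimately show ?thesis
    using \<delta>(1) by (intro exI[of _ R'] conjI exI[of _ \<tau>]) (auto simp: R'_def)
qed

text \<open>By time \<open>T0\<close> the four confining balls have been moved to the origin. A point outside the
  ball of radius \<open>\<rho>\<close> about the origin, but inside the diamond, has a coordinate larger than \<open>R' / 2\<close> in absolute
  value, because the square of side \<open>R'\<close> about the origin is contained in this ball. So it is covered by one of the four
  half planes, and all of \<open>{u > c}\<close> lies in the ball, which then shrinks to nothing.\<close>

lemma small_diamond_evacuated:
  assumes sub: "barrier_subsolution \<nu> \<Psi>m u" and cont: "continuous_on spacetime u"
    and \<nu>: "0 < \<nu>" and R: "0 < R" "R < sqrt 2 * inverse \<nu>"
  shows "\<exists>R'>R. \<exists>\<tau>>0. \<forall>T>\<tau>. \<forall>c. confined u \<Psi>m R' T c \<longrightarrow> u (x, T) \<le> c"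
proof -
  have "R / sqrt 2 < inverse \<nu>" using R(2) by (simp add: pos_divide_less_eq mult.commute)
  then obtain \<rho> where \<rho>: "R / sqrt 2 < \<rho>" "\<rho> < inverse \<nu>" using dense by blast
  have "0 < R / sqrt 2" using R(1) by simp
  then have \<rho>0: "0 < \<rho>" using \<rho>(1) by linarith
  have "\<nu> * \<rho> < 1" using \<rho>(2) \<nu> by (simp add: field_simps)
  have "R < sqrt 2 * \<rho>" using \<rho>(1) by (simp add: pos_divide_less_eq mult.commute)
  then obtain R' where R': "R < R'" "R' < sqrt 2 * \<rho>" using dense by blast
  define T0 where "T0 = \<rho> * \<bar>\<rho> - R'\<bar> / (1 - \<nu> * \<rho>) + 1"
  have "0 < T0" using \<rho>0 \<open>\<nu> * \<rho> < 1\<close> by (simp add: T0_def add_nonneg_pos)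
  have speed: "\<rho> * (\<nu> + \<bar>0 - R' + \<rho>\<bar> / T0) < 1"
  proof -
    have "\<rho> * \<bar>\<rho> - R'\<bar> / (1 - \<nu> * \<rho>) < T0" by (simp add: T0_def)
    then have "\<rho> * \<bar>\<rho> - R'\<bar> < (1 - \<nu> * \<rho>) * T0"
      using \<open>\<nu> * \<rho> < 1\<close> by (simp add: pos_divide_less_eq mult.commute)
    then have "\<rho> * \<bar>\<rho> - R'\<bar> / T0 < 1 - \<nu> * \<rho>"
      using \<open>0 < T0\<close> by (simp add: pos_divide_less_eq)
    then show ?thesis by (simp add: algebra_simps)
  qed
  define \<tau> where "\<tau> = T0 + \<rho>\<^sup>2 / (1 - \<nu> * \<rho>)"
  have "0 < \<tau>" "T0 \<le> \<tau>" using \<open>0 < T0\<close> \<open>\<nu> * \<rho> < 1\<close> by (simp_all add: \<tau>_def add_pos_nonneg)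
  moreover have "u (x, T) \<le> c" if T: "\<tau> < T" and c: "confined u \<Psi>m R' T c" for T c
  proof (rule small_ball_vanishes[OF sub cont \<nu>, of T0 T R' c \<rho>])
    have outside: "u (y, t) \<le> c" if "0 \<le> t" "t \<le> T" "R' \<le> taxicab y" for y t
      using c that by (simp add: confined_def)
    have obst: "\<Psi>m y \<le> c" if "taxicab y \<le> R'" for y
      using c that by (simp add: confined_def)
    show "0 \<le> T0" using \<open>0 < T0\<close> by simp
    show "u (y, t) \<le> c" if "T0 \<le> t" "t \<le> T" "R' \<le> taxicab y" for y t
      using outside that \<open>0 < T0\<close> by simp
    show "\<Psi>m y \<le> c" if "taxicab y \<le> R'" for y by (rule obst[OF that])
    show "0 < \<rho>" "\<nu> * \<rho> < 1" by fact+
    have "\<rho>\<^sup>2 / (1 - \<nu> * \<rho>) < T - T0" using T by (simp add: \<tau>_def)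
    then show "\<rho>\<^sup>2 < (1 - \<nu> * \<rho>) * (T - T0)"
      using \<open>\<nu> * \<rho> < 1\<close> by (simp add: pos_divide_less_eq mult.commute)
    show "u (y, T0) \<le> c" if y: "\<rho> < norm y" for y
    proof -
      have "R' / 2 < \<bar>y $ 1\<bar> \<or> R' / 2 < \<bar>y $ 2\<bar>"
      proof (rule ccontr)
        assume "\<not> ?thesis"
        then have "(y $ 1)\<^sup>2 \<le> (R' / 2)\<^sup>2" "(y $ 2)\<^sup>2 \<le> (R' / 2)\<^sup>2"
          using R R' by (auto intro!: abs_le_square_iff[THEN iffD1])
        then have "(norm y)\<^sup>2 \<le> R'\<^sup>2 / 2" unfolding norm_real2 by (simp add: power_divide)
        moreover have "R'\<^sup>2 < (sqrt 2 * \<rho>)\<^sup>2" using R R' by (intro power_strict_mono) auto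
        moreover have "\<rho>\<^sup>2 < (norm y)\<^sup>2" using y \<rho>0 by (intro power_strict_mono) auto
        ultimately show False by (simp add: power_mult_distrib)
      qed
      then obtain e f where ef: "axis_frame e f" "R' / 2 < y \<bullet> e"
        by (metis axis_frame_along)
      show ?thesis
      proof (rule corner_confinement[OF sub cont ef(1) \<open>0 < T0\<close> \<nu>, of R' c \<rho> 0])
        show "\<rho> * (\<nu> + \<bar>0 - R' + \<rho>\<bar> / T0) < 1" by (rule speed)
        show "u (y, t) \<le> c" if "0 \<le> t" "t \<le> T0" "R' \<le> taxicab y" for y t
          using outside that \<open>T0 \<le> \<tau>\<close> T by simp
      qed (use R R' \<rho>0 obst ef y in auto)
    qed
  qed
  ultimately show ?thesis using R'(1) by blast
qed

section \<open>Limits of the evolutions\<close>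

lemma level_set_solutionD:
  assumes "level_set_solution \<nu> \<Psi>m \<Psi>p u"
  shows "continuous_on spacetime u" "barrier_subsolution \<nu> \<Psi>m u"
    "barrier_subsolution (- \<nu>) (\<lambda>y. - \<Psi>p y) (\<lambda>z. - u z)"
    "continuous_on UNIV \<Psi>m" "continuous_on UNIV \<Psi>p"
    "\<exists>a<0. \<forall>T>0. \<exists>R>0. \<forall>x t. norm x \<ge> R \<longrightarrow> 0 \<le> t \<longrightarrow> t \<le> T \<longrightarrow> u (x, t) = a"
proof -
  show c: "continuous_on spacetime u"
    using assms by (auto simp: level_set_solution_def K_class_def)
  show "barrier_subsolution \<nu> \<Psi>m u" "barrier_subsolution (- \<nu>) (\<lambda>y. - \<Psi>p y) (\<lambda>z. - u z)"
    using assms c viscosity_subsolution_imp_barrier_subsolution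
      viscosity_supersolution_imp_barrier_subsolution
    unfolding level_set_solution_def viscosity_solution_def by blast+
  show "continuous_on UNIV \<Psi>m" "continuous_on UNIV \<Psi>p"
    using assms lipschitz_on_continuous_on unfolding level_set_solution_def by blast+
  show "\<exists>a<0. \<forall>T>0. \<exists>R>0. \<forall>x t. norm x \<ge> R \<longrightarrow> 0 \<le> t \<longrightarrow> t \<le> T \<longrightarrow> u (x, t) = a"
    using assms unfolding level_set_solution_def K_class_def by blast
qed

lemma compact_negative_bound:
  fixes f :: "'a::topological_space \<Rightarrow> real"
  assumes "compact K" "continuous_on K f" "\<And>x. x \<in> K \<Longrightarrow> f x < 0"
  shows "\<exists>c<0. \<forall>x\<in>K. f x \<le> c"
proof (cases "K = {}")
  case True
  then show ?thesis by (auto intro: exI[of _ "-1"])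
next
  case False
  then show ?thesis using continuous_attains_sup[OF assms(1) False assms(2)] assms(3) by blast
qed

lemma compact_positive_bound:
  fixes f :: "'a::topological_space \<Rightarrow> real"
  assumes "compact K" "continuous_on K f" "\<And>x. x \<in> K \<Longrightarrow> 0 < f x"
  shows "\<exists>c>0. \<forall>x\<in>K. c \<le> f x"
proof -
  obtain c where "c < 0" "\<forall>x\<in>K. - f x \<le> c"
    using compact_negative_bound[of K "\<lambda>x. - f x"] assms continuous_on_minus by force
  then show ?thesis by (intro exI[of _ "- c"]) force
qed

lemma set_liminf_subset_limsup: "set_liminf D \<subseteq> set_limsup D"
proof
  fix x assume "x \<in> set_liminf D"
  then obtain \<tau> where \<tau>: "\<And>t. \<tau> < t \<Longrightarrow> x \<in> D t" by (auto simp: set_liminf_def)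
  show "x \<in> set_limsup D"
    unfolding set_limsup_def
  proof clarify
    fix \<sigma> :: real assume "0 < \<sigma>"
    show "x \<in> (\<Union>t\<in>{\<sigma><..}. D t)"
      using \<tau>[of "max \<tau> \<sigma> + 1"] by (intro UN_I[of "max \<tau> \<sigma> + 1"]) auto
  qed
qed

lemma subset_set_liminfI:
  assumes "\<And>x. x \<in> A \<Longrightarrow> \<exists>\<tau>>0. \<forall>T>\<tau>. x \<in> D T"
  shows "A \<subseteq> set_liminf D"
  using assms by (fastforce simp: set_liminf_def)

lemma set_limsup_subsetI:
  assumes "\<And>x. x \<notin> A \<Longrightarrow> \<exists>\<tau>>0. \<forall>T>\<tau>. x \<notin> D T"
  shows "set_limsup D \<subseteq> A"
  using assms by (fastforce simp: set_limsup_def)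

lemma eventually_evacuated:
  assumes sub: "barrier_subsolution \<nu> \<Psi>m u" and cont: "continuous_on spacetime u"
    and \<nu>: "0 < \<nu>" and R: "0 < R"
    and A: "A = \<Union>{ball z (inverse \<nu>) | z. ball z (inverse \<nu>) \<subseteq> {x. taxicab x < R}}"
    and x: "taxicab x \<le> R" "x \<notin> closure A"
  shows "\<exists>R'>R. \<exists>\<tau>>0. \<forall>T>\<tau>. \<forall>c. confined u \<Psi>m R' T c \<longrightarrow> u (x, T) \<le> c"
proof (cases "R < sqrt 2 * inverse \<nu>")
  case True
  then show ?thesis using small_diamond_evacuated[OF sub cont \<nu> R] by blast
next
  case False
  show ?thesis
  proof (rule evacuated_beyond_corner_arc[OF sub cont \<nu> _ x(1)])
    fix z assume "taxicab z + sqrt 2 * inverse \<nu> \<le> R"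
    then have "ball z (inverse \<nu>) \<subseteq> A"
      using ball_subset_diamond_iff[of "inverse \<nu>" z R] \<nu> A by auto
    then have "closure (ball z (inverse \<nu>)) \<subseteq> closure A" by (rule closure_mono)
    then show "x \<notin> cball z (inverse \<nu>)" using x(2) \<nu> by auto
  qed (use False in auto)
qed

lemma open_evolution_limits:
  assumes \<nu>: "0 < \<nu>" and R: "0 < R" and D0: "D0 \<subseteq> {x. taxicab x < R}"
    and D: "open_evolution \<nu> D0 {} {x. taxicab x < R} D"
    and A: "A = \<Union>{ball z (inverse \<nu>) | z. ball z (inverse \<nu>) \<subseteq> {x. taxicab x < R}}"
    and cases: "(R = sqrt 2 * inverse \<nu> \<and> ball 0 (inverse \<nu>) \<subseteq> D0) \<or>
       (R < sqrt 2 * inverse \<nu>) \<or>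
       (R > sqrt 2 * inverse \<nu> \<and> (\<exists>zhat. \<exists>\<delta>>0. ball zhat (inverse \<nu> + \<delta>) \<subseteq> D0))"
  shows "A \<subseteq> set_liminf D" "set_limsup D \<subseteq> closure A"
proof -
  from D obtain \<Psi>m \<Psi>p u where u: "level_set_solution \<nu> \<Psi>m \<Psi>p u"
    and \<Psi>: "{} = {x. \<Psi>m x > 0}" "{x. taxicab x < R} = {x. \<Psi>p x > 0}"
    and level: "\<forall>t\<ge>0. D t = {x. u (x, t) > 0}" and D_0: "D 0 = D0"
    and inside: "\<forall>t\<ge>0. open (D t) \<and> {} \<subseteq> D t \<and> D t \<subseteq> {x. taxicab x < R}"
    unfolding open_evolution_def by (elim conjE exE) (rule that, assumption+)
  have Dt: "D t = {x. u (x, t) > 0}" and Dsub: "D t \<subseteq> {x. taxicab x < R}" if "0 \<le> t" for t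
    using level inside that by blast+
  note sol = level_set_solutionD[OF u]
  have u0: "continuous_on S (\<lambda>y. u (y, 0))" for S
    by (rule continuous_on_compose2[OF sol(1)]) (auto simp: spacetime_def intro!: continuous_intros)
  show "A \<subseteq> set_liminf D"
  proof (rule subset_set_liminfI)
    fix x assume "x \<in> A"
    then obtain z where z: "ball z (inverse \<nu>) \<subseteq> {x. taxicab x < R}" "x \<in> ball z (inverse \<nu>)"
      unfolding A by blast
    obtain \<tau> where \<tau>: "\<tau> > 0" "\<And>T. T > \<tau> \<Longrightarrow> occupied u \<Psi>p D0 R x T"
      using union_of_critical_balls_filled[OF sol(3,1) \<nu> D0 cases z] by blast
    have "x \<in> D T" if T: "T > \<tau>" for T
    proof -
      obtain K0 K1 where K: "compact K0" "K0 \<subseteq> D0" "compact K1" "K1 \<subseteq> {y. taxicab y < R}"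
        and le: "\<And>c. \<forall>y\<in>K0. c \<le> u (y, 0) \<Longrightarrow> \<forall>y\<in>K1. c \<le> \<Psi>p y \<Longrightarrow> c \<le> u (x, T)"
        using \<tau>(2)[OF T] unfolding occupied_def by blast
      obtain c0 where c0: "c0 > 0" "\<forall>y\<in>K0. c0 \<le> u (y, 0)"
        using compact_positive_bound[OF K(1) u0] K(2) D_0 Dt[of 0] by auto
      have "continuous_on K1 \<Psi>p" using sol(5) continuous_on_subset by blast
      then obtain c1 where c1: "c1 > 0" "\<forall>y\<in>K1. c1 \<le> \<Psi>p y"
        using compact_positive_bound[OF K(3)] K(4) \<Psi>(2) by blast
      have "min c0 c1 \<le> u (x, T)"
        using c0 c1 by (intro le) (auto simp: min.coboundedI1 min.coboundedI2)
      then show ?thesis using c0 c1 T \<tau>(1) by (simp add: Dt)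
    qed
    then show "\<exists>\<tau>>0. \<forall>T>\<tau>. x \<in> D T" using \<tau>(1) by blast
  qed
  show "set_limsup D \<subseteq> closure A"
  proof (rule set_limsup_subsetI)
    fix x assume x: "x \<notin> closure A"
    show "\<exists>\<tau>>0. \<forall>T>\<tau>. x \<notin> D T"
    proof (cases "taxicab x < R")
      case False
      then have "x \<notin> D T" if "1 < T" for T using Dsub[of T] that by auto
      then show ?thesis by (intro exI[of _ 1]) simp
    next
      case True
      then obtain R' \<tau> where *: "R' > R" "\<tau> > 0"
        "\<And>T c. T > \<tau> \<Longrightarrow> confined u \<Psi>m R' T c \<Longrightarrow> u (x, T) \<le> c"
        using eventually_evacuated[OF sol(2,1) \<nu> R A _ x] by force
      have "confined u \<Psi>m R' T 0" for T
        unfolding confined_def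
      proof (intro conjI allI impI)
        fix y and t :: real assume "0 \<le> t" "R' \<le> taxicab y"
        then have "y \<notin> D t" using Dsub[of t] *(1) by auto
        then show "u (y, t) \<le> 0" using \<open>0 \<le> t\<close> by (simp add: Dt)
      next
        show "\<Psi>m y \<le> 0" for y using \<Psi>(1) by (auto simp: not_less[symmetric])
      qed
      then have "u (x, T) \<le> 0" if "T > \<tau>" for T using *(3) that by blast
      then show ?thesis using *(2) Dt by (intro exI[of _ \<tau>]) (auto simp: not_less)
    qed
  qed
qed

text \<open>For the upper bound a strictly negative level is needed. On the boundary of the
  diamond \<open>u\<close> may vanish, but outside a diamond of size \<open>R' > R\<close> it is negative, and bounded away from
  \<open>0\<close>: on compact sets by continuity, and far out because \<open>u\<close> is a negative constant there. The lower
  obstacle is negative everywhere and hence also bounded away from \<open>0\<close> on the diamond of size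
  \<open>R'\<close>.\<close>

lemma closed_evolution_limits:
  assumes \<nu>: "0 < \<nu>" and R: "0 < R" and D0: "D0 \<subseteq> {x. taxicab x < R}"
    and E: "closed_evolution \<nu> (closure D0) {} (closure {x. taxicab x < R}) E"
    and A: "A = \<Union>{ball z (inverse \<nu>) | z. ball z (inverse \<nu>) \<subseteq> {x. taxicab x < R}}"
    and cases: "(R = sqrt 2 * inverse \<nu> \<and> ball 0 (inverse \<nu>) \<subseteq> D0) \<or>
       (R < sqrt 2 * inverse \<nu>) \<or>
       (R > sqrt 2 * inverse \<nu> \<and> (\<exists>zhat. \<exists>\<delta>>0. ball zhat (inverse \<nu> + \<delta>) \<subseteq> D0))"
  shows "A \<subseteq> set_liminf E" "set_limsup E \<subseteq> closure A"
proof -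
  from E obtain \<Psi>m \<Psi>p u where u: "level_set_solution \<nu> \<Psi>m \<Psi>p u"
    and \<Psi>: "{} = {x. \<Psi>m x \<ge> 0}" "closure {x. taxicab x < R} = {x. \<Psi>p x \<ge> 0}"
    and level: "\<forall>t\<ge>0. E t = {x. u (x, t) \<ge> 0}" and E_0: "E 0 = closure D0"
    and inside: "\<forall>t\<ge>0. closed (E t) \<and> {} \<subseteq> E t \<and> E t \<subseteq> closure {x. taxicab x < R}"
    unfolding closed_evolution_def by (elim conjE exE) (rule that, assumption+)
  have Et: "E t = {x. u (x, t) \<ge> 0}" and Esub: "E t \<subseteq> closure {x. taxicab x < R}" if "0 \<le> t" for t
    using level inside that by blast+
  note sol = level_set_solutionD[OF u]
  have "closed {x. taxicab x \<le> R}"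
    by (intro closed_Collect_le continuous_intros continuous_on_taxicab)
  then have "closure {x. taxicab x < R} \<subseteq> {x. taxicab x \<le> R}"
    by (intro closure_minimal) auto
  then have Esub': "taxicab x \<le> R" if "0 \<le> t" "x \<in> E t" for t x
    using Esub that by blast
  show "A \<subseteq> set_liminf E"
  proof (rule subset_set_liminfI)
    fix x assume "x \<in> A"
    then obtain z where z: "ball z (inverse \<nu>) \<subseteq> {x. taxicab x < R}" "x \<in> ball z (inverse \<nu>)"
      unfolding A by blast
    obtain \<tau> where \<tau>: "\<tau> > 0" "\<And>T. T > \<tau> \<Longrightarrow> occupied u \<Psi>p D0 R x T"
      using union_of_critical_balls_filled[OF sol(3,1) \<nu> D0 cases z] by blast
    have "x \<in> E T" if T: "T > \<tau>" for T
    proof -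
      obtain K0 K1 where K: "K0 \<subseteq> D0" "K1 \<subseteq> {y. taxicab y < R}"
        and le: "\<And>c. \<forall>y\<in>K0. c \<le> u (y, 0) \<Longrightarrow> \<forall>y\<in>K1. c \<le> \<Psi>p y \<Longrightarrow> c \<le> u (x, T)"
        using \<tau>(2)[OF T] unfolding occupied_def by blast
      have "0 \<le> u (y, 0)" if "y \<in> K0" for y
        using that K(1) closure_subset E_0 Et[of 0] by blast
      moreover have "0 \<le> \<Psi>p y" if "y \<in> K1" for y
        using that K(2) closure_subset \<Psi>(2) by blast
      ultimately have "0 \<le> u (x, T)" by (intro le) auto
      then show ?thesis using T \<tau>(1) by (simp add: Et)
    qed
    then show "\<exists>\<tau>>0. \<forall>T>\<tau>. x \<in> E T" using \<tau>(1) by blast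
  qed
  show "set_limsup E \<subseteq> closure A"
  proof (rule set_limsup_subsetI)
    fix x assume x: "x \<notin> closure A"
    show "\<exists>\<tau>>0. \<forall>T>\<tau>. x \<notin> E T"
    proof (cases "taxicab x \<le> R")
      case False
      then have "x \<notin> E T" if "1 < T" for T using Esub'[of T x] that by auto
      then show ?thesis by (intro exI[of _ 1]) simp
    next
      case True
      then obtain R' \<tau> where *: "R' > R" "\<tau> > 0"
        "\<And>T c. T > \<tau> \<Longrightarrow> confined u \<Psi>m R' T c \<Longrightarrow> u (x, T) \<le> c"
        using eventually_evacuated[OF sol(2,1) \<nu> R A True x] by blast
      have "x \<notin> E T" if T: "T > \<tau>" for T
      proof -
        have "0 < T" using T *(2) by simp
        then obtain a B where a: "a < 0" "\<And>y t. norm y \<ge> B \<Longrightarrow> 0 \<le> t \<Longrightarrow> t \<le> T \<Longrightarrow> u (y, t) = a"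
          using sol(6) by meson
        define S where "S = {y. R' \<le> taxicab y} \<inter> cball 0 B"
        have "closed {y. R' \<le> taxicab y}"
          by (intro closed_Collect_le continuous_intros continuous_on_taxicab)
        then have "compact (S \<times> {0..T})"
          unfolding S_def by (intro compact_Times closed_Int_compact) auto
        moreover have "continuous_on (S \<times> {0..T}) u"
          by (rule continuous_on_subset[OF sol(1)]) (auto simp: spacetime_def)
        moreover have "u z < 0" if zS: "z \<in> S \<times> {0..T}" for z
        proof -
          obtain y t where z: "z = (y, t)" "R' \<le> taxicab y" "0 \<le> t"
            using zS by (auto simp: S_def)
          then have "y \<notin> E t" using Esub'[of t y] *(1) by auto
          then show ?thesis using z by (simp add: Et)
        qed
        ultimately obtain c1 where c1: "c1 < 0" "\<forall>z\<in>S \<times> {0..T}. u z \<le> c1"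
          using compact_negative_bound by blast
        have "\<Psi>m y < 0" for y using \<Psi>(1) by (auto simp: not_le[symmetric])
        moreover have "continuous_on {y. taxicab y \<le> R'} \<Psi>m" using sol(4) continuous_on_subset by blast
        ultimately obtain c2 where c2: "c2 < 0" "\<And>y. taxicab y \<le> R' \<Longrightarrow> \<Psi>m y \<le> c2"
          using compact_negative_bound[OF compact_taxicab_ball] by blast
        have "confined u \<Psi>m R' T (Max {a, c1, c2})"
          unfolding confined_def
        proof (intro conjI allI impI)
          fix y t assume yt: "0 \<le> t" "t \<le> T" "R' \<le> taxicab y"
          show "u (y, t) \<le> Max {a, c1, c2}"
          proof (cases "norm y \<ge> B")
            case True
            then show ?thesis using a(2)[of y t] yt by simp
          next
            case False
            then have "u (y, t) \<le> c1" using c1(2) yt by (auto simp: S_def)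
            then show ?thesis by simp
          qed
        next
          show "\<Psi>m y \<le> Max {a, c1, c2}" if "taxicab y \<le> R'" for y using c2(2)[OF that] by simp
        qed
        then have "u (x, T) \<le> Max {a, c1, c2}" by (rule *(3)[OF T])
        also have "\<dots> < 0" using a(1) c1(1) c2(1) by simp
        finally show ?thesis using \<open>0 < T\<close> by (simp add: Et)
      qed
      then show ?thesis using *(2) by blast
    qed
  qed
qed

theorem proposition4p16:
  fixes \<nu> R :: real
    and Oplus A D0 :: "(real^2) set"
    and D E :: "real \<Rightarrow> (real^2) set"
  assumes nu_pos: "\<nu> > 0" and R_pos: "R > 0"
    and Oplus_eq: "Oplus = {x. \<bar>x $ 1\<bar> + \<bar>x $ 2\<bar> < R}"
    and D0: "open D0" "D0 \<subseteq> Oplus"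
    and D: "open_evolution \<nu> D0 {} Oplus D"
    and E: "closed_evolution \<nu> (closure D0) {} (closure Oplus) E"
    and A_eq: "A = \<Union>{ball z (inverse \<nu>) | z. ball z (inverse \<nu>) \<subseteq> Oplus}"
    and cases:
      "(R = sqrt 2 * inverse \<nu> \<and> ball 0 (inverse \<nu>) \<subseteq> D0) \<or>
       (R < sqrt 2 * inverse \<nu>) \<or>
       (R > sqrt 2 * inverse \<nu> \<and> (\<exists>zhat. \<exists>\<delta>>0. ball zhat (inverse \<nu> + \<delta>) \<subseteq> D0))"
  shows "(A \<subseteq> set_liminf D \<and> set_liminf D \<subseteq> set_limsup D \<and> set_limsup D \<subseteq> closure A) \<and>
         (A \<subseteq> set_liminf E \<and> set_liminf E \<subseteq> set_limsup E \<and> set_limsup E \<subseteq> closure A)"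
proof -
  have Oplus: "Oplus = {x. taxicab x < R}"
    by (simp add: Oplus_eq taxicab_def)
  show ?thesis
    using open_evolution_limits[OF nu_pos R_pos D0(2)[unfolded Oplus] D[unfolded Oplus]
        A_eq[unfolded Oplus] cases]
      closed_evolution_limits[OF nu_pos R_pos D0(2)[unfolded Oplus] E[unfolded Oplus]
        A_eq[unfolded Oplus] cases]
    by (simp add: set_liminf_subset_limsup)
qed

end
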